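(* If $\langle\mathbb A,\sigma\restriction\mathbb A\rangle$ is an elementary substructure of $\langle\mathcal P(\omega)/\mathrm{Fin},\sigma\rangle$, then $\langle\mathbb A,\sigma\restriction\mathbb A\rangle$ is polarized.
   Context: $\mathcal P(\omega)/\mathrm{Fin}$ is $\mathcal P(\omega)$ modulo finite sets, $\sigma([A])=[A+1]$. Elementary substructure: $\mathbb A$ is a subalgebra closed under $\sigma,\sigma^{-1}$ such that every first-order formula with parameters from $\mathbb A$, in the language with constants $\mathbf 0,\mathbf 1$, the Boolean operations, $\le$, and unary symbols for the automorphism and its inverse, has the same truth value in $\langle\mathbb A,\sigma\restriction\mathbb A\rangle$ and in $\langle\mathcal P(\omega)/\mathrm{Fin},\sigma\rangle$. For a Boolean algebra $\mathbb A$ with automorphism $\alpha$: partitions are finite sets of nonzero pairwise disjoint elements with join $\mathbf 1$; refinement and the natural map $\pi$ are as usual; $x\to_\alpha y$ iff $\alpha(x)\wedge y\ne\mathbf 0$. An epimorphism of finite digraphs $\phi:\langle\mathcal V,\to_{\mathcal V}\rangle\to\langle\mathcal U,\to_{\mathcal U}\rangle$ is a surjection with $u\to_{\mathcal U}u'$ iff some $v\in\phi^{-1}(u),v'\in\phi^{-1}(u')$ have $v\to_{\mathcal V}v'$. A virtual refinement of $\langle\mathcal A,\to_\alpha\rangle$ is $(\phi,\langle\mathcal V,\to\rangle)$ with $\mathcal V$ strongly connected and $\phi$ an epimorphism onto $\langle\mathcal A,\to_\alpha\rangle$; a partition $\mathcal A'$ realizes it if $\mathcal A'$ refines $\mathcal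 A$ and a digraph isomorphism $\psi:\langle\mathcal V,\to\rangle\to\langle\mathcal A',\to_\alpha\rangle$ has $\pi\circ\psi=\phi$. Epimorphisms $\phi,\psi$ onto the same digraph from strongly connected digraphs are compatible if some strongly connected $\mathcal W$ has epimorphisms $\bar\phi,\bar\psi$ onto their domains with $\phi\circ\bar\phi=\psi\circ\bar\psi$. A virtual refinement is polarized if either some partition realizes it or some partition $\mathcal A'$ refining $\mathcal A$ has its natural map incompatible with $\phi$; the system is polarized if all virtual refinements of all partitions' digraphs are polarized. *)

theory Defs
  imports Main "Graph_Theory.Graph_Theory"
begin

section \<open>The dynamical system \<open>\<langle>\<P>(\<omega>)/Fin, \<sigma>\<rangle>\<close>\<close>

quotient_type pfin = "nat set" / "\<lambda>A B. finite ((A - B) \<union> (B - A))"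
proof (rule equivpI)
  show "reflp (\<lambda>A B::nat set. finite ((A - B) \<union> (B - A)))"
    by (auto intro: reflpI)
  show "symp (\<lambda>A B::nat set. finite ((A - B) \<union> (B - A)))"
    by (auto intro!: sympI)
  show "transp (\<lambda>A B::nat set. finite ((A - B) \<union> (B - A)))"
  proof (rule transpI)
    fix A B C :: "nat set"
    assume "finite ((A - B) \<union> (B - A))" "finite ((B - C) \<union> (C - B))"
    then have "finite (((A - B) \<union> (B - A)) \<union> ((B - C) \<union> (C - B)))" by blast
    then show "finite ((A - C) \<union> (C - A))" by (rule rev_finite_subset) auto
  qed
qed

lemma finite_mod_subset:
  fixes X :: "nat set"
  assumes "X \<subseteq> ((A - B) \<union> (B - A)) \<union> ((C - D) \<union> (D - C))"
    and "finite ((A - B) \<union> (B - A))" "finite ((C - D) \<union> (D - C))"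
  shows "finite X"
  using assms(2,3) by (intro finite_subset[OF assms(1)]) blast

lemma finite_mod_subset2:
  fixes X :: "nat set"
  assumes "finite Y" "X \<subseteq> ((A - B) \<union> (B - A)) \<union> ((C - D) \<union> (D - C)) \<union> Y"
    and "finite ((A - B) \<union> (B - A))" "finite ((C - D) \<union> (D - C))"
  shows "finite X"
  using assms(1,3,4) by (intro finite_subset[OF assms(2)]) blast

instantiation pfin :: boolean_algebra
begin

lift_definition bot_pfin :: pfin is "{}" .
lift_definition top_pfin :: pfin is "UNIV" .
lift_definition inf_pfin :: "pfin \<Rightarrow> pfin \<Rightarrow> pfin" is "(\<inter>)"
  by (erule (1) finite_mod_subset[rotated]) auto
lift_definition sup_pfin :: "pfin \<Rightarrow> pfin \<Rightarrow> pfin" is "(\<union>)"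
  by (erule (1) finite_mod_subset[rotated]) auto
lift_definition minus_pfin :: "pfin \<Rightarrow> pfin \<Rightarrow> pfin" is "(-)"
  by (erule (1) finite_mod_subset[rotated]) auto
lift_definition uminus_pfin :: "pfin \<Rightarrow> pfin" is "uminus"
  by (erule rev_finite_subset) auto
lift_definition less_eq_pfin :: "pfin \<Rightarrow> pfin \<Rightarrow> bool" is "\<lambda>A B. finite (A - B)"
proof -
  fix A B C D :: "nat set"
  assume *: "finite ((A - B) \<union> (B - A))" "finite ((C - D) \<union> (D - C))"
  show "finite (A - C) = finite (B - D)"
    by (rule iffI; erule finite_mod_subset2[OF _ _ *]) auto
qed
definition less_pfin :: "pfin \<Rightarrow> pfin \<Rightarrow> bool" where
  "less_pfin a b \<longleftrightarrow> a \<le> b \<and> \<not> b \<le> a"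

instance
proof
  fix x y z :: pfin
  show "(x < y) = (x \<le> y \<and> \<not> y \<le> x)" by (rule less_pfin_def)
  show "x \<le> x" by transfer simp
  show "x \<le> z" if "x \<le> y" "y \<le> z"
    using that
  proof transfer
    fix A B C :: "nat set"
    assume "finite (A - B)" "finite (B - C)"
    then have "finite ((A - B) \<union> (B - C))" by blast
    then show "finite (A - C)" by (rule rev_finite_subset) auto
  qed
  show "x = y" if "x \<le> y" "y \<le> x" using that by transfer simp
  show "inf x y \<le> x" "inf x y \<le> y" by (transfer; simp add: Diff_eq Int_ac)+
  show "x \<le> inf y z" if "x \<le> y" "x \<le> z" using that by transfer (simp add: Diff_Int)
  show "x \<le> sup x y" "y \<le> sup x y"
    by (transfer; rule finite_subset[of _ "{}"]; auto)+
  show "sup y z \<le> x" if "y \<le> x" "z \<le> x" using that by transfer (simp add: Un_Diff)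
  show "bot \<le> x" "x \<le> top" by (transfer; simp)+
  show "sup x (inf y z) = inf (sup x y) (sup x z)"
    by transfer (rule finite_subset[of _ "{}"]; auto)
  show "inf x (- x) = bot" "sup x (- x) = top" "x - y = inf x (- y)"
    by (transfer; rule finite_subset[of _ "{}"]; auto)+
qed

end

lift_definition shift :: "pfin \<Rightarrow> pfin" is "\<lambda>A. Suc ` A"
proof -
  fix A B :: "nat set"
  assume "finite ((A - B) \<union> (B - A))"
  then have "finite (Suc ` ((A - B) \<union> (B - A)))" by blast
  then show "finite ((Suc ` A - Suc ` B) \<union> (Suc ` B - Suc ` A))"
    by (rule rev_finite_subset) auto
qed

lemma bij_shift: "bij shift"
proof (rule bijI)
  show "inj shift"
  proof (rule injI)
    fix x y assume "shift x = shift y"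
    then show "x = y"
    proof transfer
      fix A B :: "nat set"
      assume "finite ((Suc ` A - Suc ` B) \<union> (Suc ` B - Suc ` A))"
      moreover have "Suc ` ((A - B) \<union> (B - A)) \<subseteq> (Suc ` A - Suc ` B) \<union> (Suc ` B - Suc ` A)"
        by auto
      ultimately have "finite (Suc ` ((A - B) \<union> (B - A)))" by (rule rev_finite_subset)
      then show "finite ((A - B) \<union> (B - A))" by (rule finite_imageD) simp
    qed
  qed
  show "surj shift"
  proof -
    have "\<exists>x. y = shift x" for y
    proof transfer
      fix B :: "nat set"
      have "(B - Suc ` {n. Suc n \<in> B}) \<union> (Suc ` {n. Suc n \<in> B} - B) \<subseteq> {0}"
        by (auto simp: image_iff) (metis not0_implies_Suc)
      then show "\<exists>A. finite ((B - Suc ` A) \<union> (Suc ` A - B))"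
        by (meson finite.emptyI finite.insertI finite_subset)
    qed
    then show ?thesis by (simp add: surj_def)
  qed
qed

lemma shift_le_iff: "shift x \<le> shift y \<longleftrightarrow> x \<le> y"
proof transfer
  fix A B :: "nat set"
  have "Suc ` A - Suc ` B = Suc ` (A - B)" by auto
  then show "finite (Suc ` A - Suc ` B) = finite (A - B)" by (simp add: finite_image_iff)
qed


section \<open>First-order logic of Boolean algebras with an automorphism\<close>

datatype trm = Var nat | Zero | One | Meet trm trm | Join trm trm | Compl trm
  | Aut trm | AutInv trm

datatype fm = Eq trm trm | Leq trm trm | Neg fm | Conj fm fm | Exi nat fm

primrec trm_val :: "('a::boolean_algebra \<Rightarrow> 'a) \<Rightarrow> (nat \<Rightarrow> 'a) \<Rightarrow> trm \<Rightarrow> 'a" where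
  "trm_val \<alpha> e (Var n) = e n"
| "trm_val \<alpha> e Zero = bot"
| "trm_val \<alpha> e One = top"
| "trm_val \<alpha> e (Meet s t) = inf (trm_val \<alpha> e s) (trm_val \<alpha> e t)"
| "trm_val \<alpha> e (Join s t) = sup (trm_val \<alpha> e s) (trm_val \<alpha> e t)"
| "trm_val \<alpha> e (Compl t) = - trm_val \<alpha> e t"
| "trm_val \<alpha> e (Aut t) = \<alpha> (trm_val \<alpha> e t)"
| "trm_val \<alpha> e (AutInv t) = inv \<alpha> (trm_val \<alpha> e t)"

text \<open>Satisfaction in the substructure with universe \<open>S\<close>, for \<open>S\<close> closed under all operations:
  these are the restrictions of the ambient ones, so that only the quantifiers see \<open>S\<close>.\<close>

primrec sat :: "'a::boolean_algebra set \<Rightarrow> ('a \<Rightarrow> 'a) \<Rightarrow> (nat \<Rightarrow> 'a) \<Rightarrow> fm \<Rightarrow> bool" where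
  "sat S \<alpha> e (Eq s t) \<longleftrightarrow> trm_val \<alpha> e s = trm_val \<alpha> e t"
| "sat S \<alpha> e (Leq s t) \<longleftrightarrow> trm_val \<alpha> e s \<le> trm_val \<alpha> e t"
| "sat S \<alpha> e (Neg F) \<longleftrightarrow> \<not> sat S \<alpha> e F"
| "sat S \<alpha> e (Conj F G) \<longleftrightarrow> sat S \<alpha> e F \<and> sat S \<alpha> e G"
| "sat S \<alpha> e (Exi n F) \<longleftrightarrow> (\<exists>a\<in>S. sat S \<alpha> (e(n := a)) F)"

definition aut_subalgebra :: "'a::boolean_algebra set \<Rightarrow> ('a \<Rightarrow> 'a) \<Rightarrow> bool" where
  "aut_subalgebra S \<alpha> \<longleftrightarrow> bot \<in> S \<and> top \<in> S
     \<and> (\<forall>a\<in>S. \<forall>b\<in>S. inf a b \<in> S \<and> sup a b \<in> S) \<and> (\<forall>a\<in>S. - a \<in> S)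
     \<and> (\<forall>a\<in>S. \<alpha> a \<in> S \<and> inv \<alpha> a \<in> S)"

text \<open>A formula with parameters from \<open>S\<close> is a formula together with an assignment of elements of
  \<open>S\<close> to its free variables.\<close>

definition elementary_substructure :: "'a::boolean_algebra set \<Rightarrow> ('a \<Rightarrow> 'a) \<Rightarrow> bool" where
  "elementary_substructure S \<alpha> \<longleftrightarrow> aut_subalgebra S \<alpha>
     \<and> (\<forall>F e. range e \<subseteq> S \<longrightarrow> (sat S \<alpha> e F \<longleftrightarrow> sat UNIV \<alpha> e F))"


section \<open>Partitions and finite digraphs\<close>

text \<open>A Boolean algebra is given as a subalgebra \<open>S\<close> of an ambient one. The element \<open>bot\<close> is
  inserted because \<open>Sup_fin\<close> is unspecified on the empty set.\<close>

definition ba_partition :: "'a::boolean_algebra set \<Rightarrow> 'a set \<Rightarrow> bool" where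
  "ba_partition S P \<longleftrightarrow> finite P \<and> P \<subseteq> S \<and> bot \<notin> P \<and> pairwise (\<lambda>a b. inf a b = bot) P
     \<and> Sup_fin (insert bot P) = top"

definition ba_refines :: "'a::boolean_algebra set \<Rightarrow> 'a set \<Rightarrow> bool" where
  "ba_refines P' P \<longleftrightarrow> (\<forall>a'\<in>P'. \<exists>a\<in>P. a' \<le> a)"

definition natural_map :: "'a::boolean_algebra set \<Rightarrow> 'a \<Rightarrow> 'a" where
  "natural_map P a' = (THE a. a \<in> P \<and> a' \<le> a)"

definition partition_digraph ::
  "('a::boolean_algebra \<Rightarrow> 'a) \<Rightarrow> 'a set \<Rightarrow> 'a pair_pre_digraph" where
  "partition_digraph \<alpha> P =
     \<lparr>pverts = P, parcs = {(x, y). x \<in> P \<and> y \<in> P \<and> inf (\<alpha> x) y \<noteq> bot}\<rparr>"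

definition digraph_epi ::
  "('v \<Rightarrow> 'u) \<Rightarrow> 'v pair_pre_digraph \<Rightarrow> 'u pair_pre_digraph \<Rightarrow> bool" where
  "digraph_epi \<phi> V U \<longleftrightarrow> pair_fin_digraph V \<and> pair_fin_digraph U \<and> \<phi> ` pverts V = pverts U
     \<and> (\<forall>u\<in>pverts U. \<forall>u'\<in>pverts U. (u, u') \<in> parcs U \<longleftrightarrow>
          (\<exists>v\<in>pverts V. \<exists>v'\<in>pverts V. \<phi> v = u \<and> \<phi> v' = u' \<and> (v, v') \<in> parcs V))"

definition digraph_isom ::
  "('v \<Rightarrow> 'u) \<Rightarrow> 'v pair_pre_digraph \<Rightarrow> 'u pair_pre_digraph \<Rightarrow> bool" where
  "digraph_isom \<psi> V U \<longleftrightarrow> bij_betw \<psi> (pverts V) (pverts U)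
     \<and> (\<forall>v\<in>pverts V. \<forall>v'\<in>pverts V. (v, v') \<in> parcs V \<longleftrightarrow> (\<psi> v, \<psi> v') \<in> parcs U)"


section \<open>Virtual refinements and polarization\<close>

definition virtual_refinement ::
  "('a::boolean_algebra \<Rightarrow> 'a) \<Rightarrow> 'a set \<Rightarrow> ('v \<Rightarrow> 'a) \<Rightarrow> 'v pair_pre_digraph \<Rightarrow> bool" where
  "virtual_refinement \<alpha> P \<phi> V \<longleftrightarrow>
     strongly_connected (with_proj V) \<and> digraph_epi \<phi> V (partition_digraph \<alpha> P)"

definition realizes :: "'a::boolean_algebra set \<Rightarrow> ('a \<Rightarrow> 'a) \<Rightarrow> 'a set \<Rightarrow> 'a set
    \<Rightarrow> ('v \<Rightarrow> 'a) \<Rightarrow> 'v pair_pre_digraph \<Rightarrow> bool" where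
  "realizes S \<alpha> P' P \<phi> V \<longleftrightarrow> ba_partition S P' \<and> ba_refines P' P
     \<and> (\<exists>\<psi>. digraph_isom \<psi> V (partition_digraph \<alpha> P')
          \<and> (\<forall>v\<in>pverts V. natural_map P (\<psi> v) = \<phi> v))"

text \<open>Here \<open>\<phi>\<close> and \<open>\<psi>\<close> are epimorphisms with strongly connected domains \<open>V\<close> and \<open>U\<close> and a common
  codomain. Taking the vertices of \<open>W\<close> in \<open>nat\<close> loses nothing, see \<open>compatibleI\<close> below.\<close>

definition compatible ::
  "('v \<Rightarrow> 'a) \<Rightarrow> 'v pair_pre_digraph \<Rightarrow> ('u \<Rightarrow> 'a) \<Rightarrow> 'u pair_pre_digraph \<Rightarrow> bool" where
  "compatible \<phi> V \<psi> U \<longleftrightarrow> (\<exists>(W :: nat pair_pre_digraph) \<phi>' \<psi>'.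
     strongly_connected (with_proj W) \<and> digraph_epi \<phi>' W V \<and> digraph_epi \<psi>' W U
     \<and> (\<forall>w\<in>pverts W. \<phi> (\<phi>' w) = \<psi> (\<psi>' w)))"

text \<open>The strong connectedness of \<open>P'\<close> is what makes (in)compatibility with its natural map
  meaningful; without it the negation of \<open>compatible\<close> would hold vacuously.\<close>

definition polarized_refinement :: "'a::boolean_algebra set \<Rightarrow> ('a \<Rightarrow> 'a) \<Rightarrow> 'a set
    \<Rightarrow> ('v \<Rightarrow> 'a) \<Rightarrow> 'v pair_pre_digraph \<Rightarrow> bool" where
  "polarized_refinement S \<alpha> P \<phi> V \<longleftrightarrow>
     (\<exists>P'. realizes S \<alpha> P' P \<phi> V) \<or>
     (\<exists>P'. ba_partition S P' \<and> ba_refines P' P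
        \<and> strongly_connected (with_proj (partition_digraph \<alpha> P'))
        \<and> \<not> compatible (natural_map P) (partition_digraph \<alpha> P') \<phi> V)"

text \<open>Again vertices in \<open>nat\<close> suffice, see \<open>polarizedD\<close> below.\<close>

definition polarized :: "'a::boolean_algebra set \<Rightarrow> ('a \<Rightarrow> 'a) \<Rightarrow> bool" where
  "polarized S \<alpha> \<longleftrightarrow> (\<forall>P (\<phi> :: nat \<Rightarrow> 'a) V.
     ba_partition S P \<and> virtual_refinement \<alpha> P \<phi> V \<longrightarrow> polarized_refinement S \<alpha> P \<phi> V)"


subsection \<open>Independence of the vertex type\<close>

lemma nat_copy:
  fixes V :: "'v pair_pre_digraph"
  assumes "pair_fin_digraph V"
  obtains f g and V' :: "nat pair_pre_digraph" where
    "digraph_isom f V V'" "digraph_epi f V V'" "digraph_epi g V' V"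
    "\<And>v. v \<in> pverts V \<Longrightarrow> g (f v) = v" "\<And>v. v \<in> pverts V' \<Longrightarrow> f (g v) = v"
    "strongly_connected (with_proj V) \<Longrightarrow> strongly_connected (with_proj V')"
proof -
  interpret pair_fin_digraph V by fact
  obtain f :: "'v \<Rightarrow> nat" where f: "inj_on f (pverts V)"
    using finite_imp_inj_to_nat_seg[OF pair_finite_verts] by blast
  define V' where "V' = \<lparr>pverts = f ` pverts V, parcs = map_prod f f ` parcs V\<rparr>"
  define g where "g = inv_into (pverts V) f"
  have gf: "g (f v) = v" if "v \<in> pverts V" for v using f that by (simp add: g_def)
  have fg: "f (g v) = v" if "v \<in> pverts V'" for v
    using that by (auto simp: V'_def gf)
  have arcs: "(f u, f v) \<in> parcs V' \<longleftrightarrow> (u, v) \<in> parcs V" if "u \<in> pverts V" "v \<in> pverts V" for u v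
  proof
    assume "(f u, f v) \<in> parcs V'"
    then obtain a b where "(a, b) \<in> parcs V" "f u = f a" "f v = f b" by (auto simp: V'_def)
    moreover from this have "a \<in> pverts V" "b \<in> pverts V" by (auto dest: in_arcsD1 in_arcsD2)
    ultimately show "(u, v) \<in> parcs V" using that gf by metis
  qed (force simp: V'_def)
  have fin': "pair_fin_digraph V'"
    by unfold_locales
      (auto simp: V'_def pair_finite_verts pair_finite_arcs dest: in_arcsD1 in_arcsD2)
  have 1: "digraph_isom f V V'"
    using f arcs by (auto simp: digraph_isom_def bij_betw_def V'_def)
  have 2: "digraph_epi f V V'"
    unfolding digraph_epi_def using assms fin' arcs by (auto simp: V'_def inj_on_eq_iff[OF f])
  have 3: "digraph_epi g V' V"
    unfolding digraph_epi_def using assms fin' arcs gf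
    by (auto simp: V'_def image_image)
  have 4: "strongly_connected (with_proj V')" if sc: "strongly_connected (with_proj V)"
  proof -
    have "(f u, f v) \<in> rtrancl_on (pverts V') (parcs V')"
      if "(u, v) \<in> rtrancl_on (pverts V) (parcs V)" for u v
      using that
    proof induct
      case base then show ?case by (auto simp: V'_def intro: rtrancl_on_refl)
    next
      case (step x y)
      then have "(f x, f y) \<in> parcs V'" "f x \<in> pverts V'" by (auto simp: V'_def)
      with step show ?case by (meson converse_rtrancl_on_into_rtrancl_on)
    qed
    then show ?thesis using sc
      by (auto simp: strongly_connected_def reachable_def V'_def)
  qed
  show thesis using that[OF 1 2 3 gf fg 4] by blast
qed

lemma digraph_epi_comp:
  assumes "digraph_epi f U V" "digraph_epi g V W"
  shows "digraph_epi (g \<circ> f) U W"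
proof -
  have "g ` f ` pverts U = pverts W" using assms by (auto simp: digraph_epi_def)
  moreover have "(w, w') \<in> parcs W \<longleftrightarrow>
      (\<exists>u\<in>pverts U. \<exists>u'\<in>pverts U. (g \<circ> f) u = w \<and> (g \<circ> f) u' = w' \<and> (u, u') \<in> parcs U)"
    if "w \<in> pverts W" "w' \<in> pverts W" for w w'
  proof -
    have V: "f u \<in> pverts V" if "u \<in> pverts U" for u
      using assms that by (auto simp: digraph_epi_def)
    have "(w, w') \<in> parcs W \<longleftrightarrow> (\<exists>v\<in>pverts V. \<exists>v'\<in>pverts V. g v = w \<and> g v' = w'
        \<and> (\<exists>u\<in>pverts U. \<exists>u'\<in>pverts U. f u = v \<and> f u' = v' \<and> (u, u') \<in> parcs U))"
      using assms that by (simp add: digraph_epi_def)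
    then show ?thesis using V by fastforce
  qed
  ultimately show ?thesis
    using assms unfolding digraph_epi_def image_comp[symmetric] by blast
qed

lemma compatibleI:
  fixes W :: "'w pair_pre_digraph"
  assumes "strongly_connected (with_proj W)" "digraph_epi \<phi>' W V" "digraph_epi \<psi>' W U"
    and "\<And>w. w \<in> pverts W \<Longrightarrow> \<phi> (\<phi>' w) = \<psi> (\<psi>' w)"
  shows "compatible \<phi> V \<psi> U"
proof -
  have "pair_fin_digraph W" using assms(2) by (simp add: digraph_epi_def)
  then obtain f g and W' :: "nat pair_pre_digraph" where *: "digraph_epi g W' W"
    "strongly_connected (with_proj W')"
    using assms(1) by (elim nat_copy) blast
  then have "g w \<in> pverts W" if "w \<in> pverts W'" for w
    using that by (auto simp: digraph_epi_def)
  then show ?thesis unfolding compatible_def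
    using * assms(4) digraph_epi_comp[OF *(1) assms(2)] digraph_epi_comp[OF *(1) assms(3)]
    by (intro exI[of _ W'] exI[of _ "\<phi>' \<circ> g"] exI[of _ "\<psi>' \<circ> g"]) auto
qed

lemma polarizedD:
  fixes V :: "'v pair_pre_digraph"
  assumes "polarized S \<alpha>" "ba_partition S P" "virtual_refinement \<alpha> P \<phi> V"
  shows "polarized_refinement S \<alpha> P \<phi> V"
proof -
  have V: "strongly_connected (with_proj V)" "digraph_epi \<phi> V (partition_digraph \<alpha> P)"
    using assms(3) by (auto simp: virtual_refinement_def)
  then have "pair_fin_digraph V" by (simp add: digraph_epi_def)
  then obtain f g and V' :: "nat pair_pre_digraph" where *:
    "digraph_isom f V V'" "digraph_epi f V V'" "digraph_epi g V' V"
    "\<And>v. v \<in> pverts V \<Longrightarrow> g (f v) = v" "\<And>v. v \<in> pverts V' \<Longrightarrow> f (g v) = v"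
    "strongly_connected (with_proj V')"
    using V(1) by (elim nat_copy) blast
  have f: "f v \<in> pverts V'" if "v \<in> pverts V" for v using *(2) that by (auto simp: digraph_epi_def)
  have "virtual_refinement \<alpha> P (\<phi> \<circ> g) V'"
    using digraph_epi_comp[OF *(3) V(2)] *(6) by (simp add: virtual_refinement_def)
  with assms(1,2) have "polarized_refinement S \<alpha> P (\<phi> \<circ> g) V'"
    by (auto simp: polarized_def)
  moreover have "realizes S \<alpha> P' P \<phi> V" if r: "realizes S \<alpha> P' P (\<phi> \<circ> g) V'" for P'
  proof -
    from r obtain \<psi> where \<psi>: "digraph_isom \<psi> V' (partition_digraph \<alpha> P')"
      "\<forall>v\<in>pverts V'. natural_map P (\<psi> v) = (\<phi> \<circ> g) v"
      by (auto simp: realizes_def)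
    have "digraph_isom (\<psi> \<circ> f) V (partition_digraph \<alpha> P')"
      using *(1) \<psi>(1) f unfolding digraph_isom_def by (auto intro: bij_betw_trans)
    moreover have "\<forall>v\<in>pverts V. natural_map P ((\<psi> \<circ> f) v) = \<phi> v"
      using \<psi>(2) f *(4) by simp
    ultimately show ?thesis using r unfolding realizes_def by blast
  qed
  moreover have "compatible \<chi> U (\<phi> \<circ> g) V'" if "compatible \<chi> U \<phi> V"
    for \<chi> and U :: "'a pair_pre_digraph"
  proof -
    from that obtain W :: "nat pair_pre_digraph" and h k where W:
      "strongly_connected (with_proj W)" "digraph_epi h W U" "digraph_epi k W V"
      "\<forall>w\<in>pverts W. \<chi> (h w) = \<phi> (k w)"
      unfolding compatible_def by blast
    have "k w \<in> pverts V" if "w \<in> pverts W" for w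
      using W(3) that by (auto simp: digraph_epi_def)
    then show ?thesis
      using W *(4) by (intro compatibleI[OF W(1,2) digraph_epi_comp[OF W(3) *(2)]]) auto
  qed
  ultimately show ?thesis unfolding polarized_refinement_def by blast
qed

end

theory Submission
  imports Defs "HOL-Library.Ramsey"
begin

text \<open>A partition with a prescribed digraph and prescribed upper bounds for its members is a solution
  of a first-order formula, so it exists in an elementary substructure as soon as it exists in
  \<open>\<P>(\<omega>)/Fin\<close>. There, a partition is a sequence \<open>c\<close> with finite range, and its digraph consists of the
  transitions that \<open>c\<close> makes infinitely often.

  The type of an interval is the set of triples (start, set of arcs used, end) of the lifts of \<open>c\<close> on
  that interval to walks in \<open>V\<close>. By Ramsey's theorem there is an infinite set \<open>H\<close> such that all intervals
  with endpoints in \<open>H\<close> have the same type \<open>t\<close>. Refine \<open>c\<close> to a sequence \<open>d\<close> that records the type since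
  the last point of \<open>H\<close>. If the digraph of \<open>d\<close> is compatible with \<open>\<phi>\<close> via \<open>W\<close>, then a closed walk in \<open>W\<close>
  that covers all arcs of \<open>V\<close> shows that \<open>t\<close> contains a lift from some \<open>v\<close> to \<open>v\<close> using every arc; gluing
  such lifts along \<open>H\<close> realizes \<open>\<phi>\<close>. Otherwise the partition given by \<open>d\<close> is incompatible with \<open>\<phi>\<close>.\<close>

section \<open>Labelled partitions\<close>

text \<open>\<open>V\<close> prescribes the digraph and \<open>\<phi>\<close> an upper bound for the
  member at each vertex; \<open>f\<close> plays the role of the isomorphism in
  \<open>realizes\<close>. The bound \<open>f v \<le> \<phi> v\<close> stands in for
  \<open>natural_map\<close>, so that for finite \<open>V\<close> every clause after the first is a
  first-order condition on the members with parameters \<open>\<phi> v\<close>.\<close>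

definition labelled_partition :: "'a::boolean_algebra set \<Rightarrow> ('a \<Rightarrow> 'a)
    \<Rightarrow> ('v \<Rightarrow> 'a) \<Rightarrow> 'v pair_pre_digraph \<Rightarrow> ('v \<Rightarrow> 'a) \<Rightarrow> bool" where
  "labelled_partition S \<alpha> \<phi> V f \<longleftrightarrow> f ` pverts V \<subseteq> S
     \<and> (\<forall>v\<in>pverts V. f v \<noteq> bot \<and> f v \<le> \<phi> v)
     \<and> (\<forall>v\<in>pverts V. \<forall>w\<in>pverts V. v \<noteq> w \<longrightarrow> inf (f v) (f w) = bot)
     \<and> Sup_fin (insert bot (f ` pverts V)) = top
     \<and> (\<forall>v\<in>pverts V. \<forall>w\<in>pverts V. (v, w) \<in> parcs V \<longleftrightarrow> inf (\<alpha> (f v)) (f w) \<noteq> bot)"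

lemma natural_map_eq:
  assumes "ba_partition S P" "a \<in> P" "x \<le> a" "x \<noteq> bot"
  shows "natural_map P x = a"
  unfolding natural_map_def
proof (rule the_equality)
  fix b assume b: "b \<in> P \<and> x \<le> b"
  show "b = a"
  proof (rule ccontr)
    assume "b \<noteq> a"
    then have "inf b a = bot" using assms b by (auto simp: ba_partition_def pairwise_def)
    then show False using assms b by (metis bot.extremum_unique le_infI)
  qed
qed (use assms in auto)

text \<open>A common value at two distinct vertices would be disjoint from itself, hence
  \<open>bot\<close>.\<close>

lemma labelled_partition_inj_on:
  assumes "labelled_partition S \<alpha> \<phi> V f"
  shows "inj_on f (pverts V)"
  using assms unfolding labelled_partition_def inj_on_def by (metis inf.idem)

lemma labelled_partition_ba_partition:
  assumes "labelled_partition S \<alpha> \<phi> V f" "finite (pverts V)"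
  shows "ba_partition S (f ` pverts V)"
  using assms unfolding labelled_partition_def ba_partition_def
  by (auto simp: pairwise_def)

lemma labelled_partition_refines:
  assumes "labelled_partition S \<alpha> \<phi> V f" "\<phi> ` pverts V \<subseteq> P"
  shows "ba_refines (f ` pverts V) P"
  using assms unfolding labelled_partition_def ba_refines_def by blast

lemma labelled_partition_natural_map:
  assumes "labelled_partition S \<alpha> \<phi> V f" "\<phi> ` pverts V \<subseteq> P" "ba_partition S' P" "v \<in> pverts V"
  shows "natural_map P (f v) = \<phi> v"
  using assms by (intro natural_map_eq[OF assms(3)]) (auto simp: labelled_partition_def)

lemma labelled_partition_isom:
  assumes "labelled_partition S \<alpha> \<phi> V f"
  shows "digraph_isom f V (partition_digraph \<alpha> (f ` pverts V))"
  using assms labelled_partition_inj_on[OF assms]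
  by (auto simp: digraph_isom_def bij_betw_def partition_digraph_def labelled_partition_def)

lemma labelled_partition_realizes:
  assumes "labelled_partition S \<alpha> \<phi> V f" "\<phi> ` pverts V \<subseteq> P" "ba_partition S' P"
    and "finite (pverts V)"
  shows "realizes S \<alpha> (f ` pverts V) P \<phi> V"
  unfolding realizes_def
  using labelled_partition_ba_partition[OF assms(1,4)] labelled_partition_refines[OF assms(1,2)]
    labelled_partition_isom[OF assms(1)] labelled_partition_natural_map[OF assms(1-3)]
  by blast

text \<open>Since \<open>f\<close> is an isomorphism onto the digraph of its partition and
  \<open>natural_map P (f v) = \<phi> v\<close>, composing with the inverse of \<open>f\<close>
  carries a witness \<open>W\<close> back to \<open>V\<close>. Read contrapositively,
  incompatibility of an abstract digraph passes to any partition with that digraph and those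
  labels.\<close>

lemma labelled_partition_compatible:
  assumes f: "labelled_partition S \<alpha> \<phi> V f" and \<phi>: "\<phi> ` pverts V \<subseteq> P" and P: "ba_partition S' P"
    and V: "pair_fin_digraph V"
    and comp: "compatible (natural_map P) (partition_digraph \<alpha> (f ` pverts V)) \<psi> U"
  shows "compatible \<phi> V \<psi> U"
proof -
  obtain W :: "nat pair_pre_digraph" and h k where W:
      "strongly_connected (with_proj W)"
      "digraph_epi h W (partition_digraph \<alpha> (f ` pverts V))" "digraph_epi k W U"
      "\<forall>w\<in>pverts W. natural_map P (h w) = \<psi> (k w)"
    using comp unfolding compatible_def by blast
  define g where "g = inv_into (pverts V) f"
  have gf: "g (f v) = v" if "v \<in> pverts V" for v
    using labelled_partition_inj_on[OF f] that by (simp add: g_def)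
  have "digraph_epi g (partition_digraph \<alpha> (f ` pverts V)) V"
    unfolding digraph_epi_def
  proof (intro conjI ballI)
    show "pair_fin_digraph (partition_digraph \<alpha> (f ` pverts V))"
      using W(2) by (simp add: digraph_epi_def)
    show "g ` pverts (partition_digraph \<alpha> (f ` pverts V)) = pverts V"
      using gf by (auto simp: partition_digraph_def image_image)
    fix u u' assume "u \<in> pverts V" "u' \<in> pverts V"
    then show "(u, u') \<in> parcs V \<longleftrightarrow> (\<exists>v\<in>pverts (partition_digraph \<alpha> (f ` pverts V)).
        \<exists>v'\<in>pverts (partition_digraph \<alpha> (f ` pverts V)).
          g v = u \<and> g v' = u' \<and> (v, v') \<in> parcs (partition_digraph \<alpha> (f ` pverts V)))"
      using gf f by (simp add: partition_digraph_def labelled_partition_def)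
  qed (rule V)
  from digraph_epi_comp[OF W(2) this] W(1,3,4) show ?thesis
  proof (rule_tac compatibleI)
    fix w assume "w \<in> pverts W"
    then obtain v where "v \<in> pverts V" "h w = f v"
      using W(2) by (force simp: digraph_epi_def partition_digraph_def)
    then show "\<phi> ((g \<circ> h) w) = \<psi> (k w)"
      using W(4) \<open>w \<in> pverts W\<close> gf labelled_partition_natural_map[OF f \<phi> P] by (metis comp_apply)
  qed
qed


section \<open>Transfer along elementary substructures\<close>

text \<open>\<open>Eq Zero Zero\<close> serves as truth, the empty conjunction.\<close>

lemma sat_foldr_Conj:
  "sat S \<alpha> e (foldr Conj Fs (Eq Zero Zero)) \<longleftrightarrow> (\<forall>F\<in>set Fs. sat S \<alpha> e F)"
  by (induction Fs) auto

lemma sat_foldr_Exi: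
  "sat S \<alpha> e (foldr Exi ns F) \<longleftrightarrow>
     (\<exists>g. g ` set ns \<subseteq> S \<and> sat S \<alpha> (\<lambda>k. if k \<in> set ns then g k else e k) F)"
proof (induction ns arbitrary: e)
  case (Cons n ns)
  show ?case
  proof
    assume "sat S \<alpha> e (foldr Exi (n # ns) F)"
    then obtain a g where *: "a \<in> S" "g ` set ns \<subseteq> S"
      "sat S \<alpha> (\<lambda>k. if k \<in> set ns then g k else (e(n := a)) k) F"
      using Cons.IH by auto
    \<comment> \<open>If \<open>n\<close> occurs again in \<open>ns\<close>, the inner quantifier
      overrides the outer one, so the value chosen there takes precedence over
      \<open>a\<close>.\<close>
    define g' where "g' = (\<lambda>k. if k \<in> set ns then g k else a)"
    have "(\<lambda>k. if k \<in> set ns then g k else (e(n := a)) k) = (\<lambda>k. if k \<in> set (n # ns) then g' k else e k)"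
      by (auto simp: g'_def)
    then show "\<exists>g. g ` set (n # ns) \<subseteq> S \<and> sat S \<alpha> (\<lambda>k. if k \<in> set (n # ns) then g k else e k) F"
      using * by (intro exI[of _ g']) (auto simp: g'_def)
  next
    assume "\<exists>g. g ` set (n # ns) \<subseteq> S \<and> sat S \<alpha> (\<lambda>k. if k \<in> set (n # ns) then g k else e k) F"
    then obtain g where *: "g ` set (n # ns) \<subseteq> S"
      "sat S \<alpha> (\<lambda>k. if k \<in> set (n # ns) then g k else e k) F" by blast
    have "(\<lambda>k. if k \<in> set (n # ns) then g k else e k) = (\<lambda>k. if k \<in> set ns then g k else (e(n := g n)) k)"
      by auto
    then have "g n \<in> S" "sat S \<alpha> (e(n := g n)) (foldr Exi ns F)"
      using * by (auto simp: Cons.IH)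
    then show "sat S \<alpha> e (foldr Exi (n # ns) F)" by auto
  qed
qed simp

lemma trm_val_foldr_Join:
  "trm_val \<alpha> e (foldr Join ts Zero) = Sup_fin (insert bot (trm_val \<alpha> e ` set ts))"
proof (induction ts)
  case (Cons t ts)
  have "Sup_fin (insert (trm_val \<alpha> e t) (insert bot (trm_val \<alpha> e ` set ts)))
      = sup (trm_val \<alpha> e t) (Sup_fin (insert bot (trm_val \<alpha> e ` set ts)))"
    by (rule Sup_fin.insert) auto
  with Cons show ?case by (simp add: insert_commute)
qed simp

text \<open>For finite \<open>V\<close> the vertices and arcs are spelled out by the finite list
  \<open>Fs\<close>, so the existence of a labelled partition is the truth of one existential
  formula with parameters \<open>\<phi> v\<close> from \<open>S\<close>.\<close>

lemma labelled_partition_transfer: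
  fixes V :: "'v pair_pre_digraph"
  assumes elem: "elementary_substructure S \<alpha>" and V: "finite (pverts V)"
    and \<phi>: "\<phi> ` pverts V \<subseteq> S" and f: "labelled_partition UNIV \<alpha> \<phi> V f"
  obtains f' where "labelled_partition S \<alpha> \<phi> V f'"
proof -
  obtain vs where vs: "set vs = pverts V" using finite_list[OF V] by blast
  obtain i :: "'v \<Rightarrow> nat" where i: "inj_on i (pverts V)"
    using finite_imp_inj_to_nat_seg[OF V] by blast
  \<comment> \<open>The unknown labelled by \<open>v\<close> is variable \<open>2 * i v\<close>; the parameter \<open>\<phi> v\<close> is variable \<open>2 * i v + 1\<close>.\<close>
  define x where "x = (\<lambda>v. Var (2 * i v))"
  define y where "y = (\<lambda>v. Var (Suc (2 * i v)))"
  \<comment> \<open>Arcs demand a nonzero meet and non-arcs a zero meet, so each pair of vertices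
    contributes an equation or its negation.\<close>
  define lit where "lit = (\<lambda>b F. if b then Neg F else F)"
  define Fs where "Fs = Eq (foldr Join (map x vs) Zero) One
     # map (\<lambda>v. Neg (Eq (x v) Zero)) vs @ map (\<lambda>v. Leq (x v) (y v)) vs
     @ map (\<lambda>(v, w). Eq (Meet (x v) (x w)) Zero) (filter (\<lambda>(v, w). v \<noteq> w) (List.product vs vs))
     @ map (\<lambda>(v, w). lit ((v, w) \<in> parcs V) (Eq (Meet (Aut (x v)) (x w)) Zero)) (List.product vs vs)"
  define ns where "ns = map (\<lambda>v. 2 * i v) vs"
  \<comment> \<open>All variables other than the parameters get \<open>bot\<close>, which keeps the
    range of \<open>e\<close> inside \<open>S\<close>; \<open>k div 2\<close> recovers
    \<open>i v\<close> from \<open>Suc (2 * i v)\<close>.\<close>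
  define e where "e = (\<lambda>k. if \<exists>v\<in>pverts V. k = Suc (2 * i v)
      then \<phi> (inv_into (pverts V) i (k div 2)) else bot)"
  have e\<phi>: "e (Suc (2 * i v)) = \<phi> v" if "v \<in> pverts V" for v
  proof -
    have "Suc (2 * i v) div 2 = i v" by simp
    then show ?thesis using that i unfolding e_def by auto
  qed
  have "bot \<in> S" using elem by (auto simp: elementary_substructure_def aut_subalgebra_def)
  then have "range e \<subseteq> S" using \<phi> i by (force simp: e_def)
  then have sat: "sat S \<alpha> e F \<longleftrightarrow> sat UNIV \<alpha> e F" for F
    using elem by (simp add: elementary_substructure_def)
  \<comment> \<open>With \<open>T\<close> arbitrary, the same formula and the same \<open>e\<close>
    serve for \<open>S\<close> and for \<open>UNIV\<close>.\<close>
  have key: "sat T \<alpha> e (foldr Exi ns (foldr Conj Fs (Eq Zero Zero))) \<longleftrightarrow>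
      (\<exists>g. labelled_partition T \<alpha> \<phi> V (\<lambda>v. g (2 * i v)))" for T
  proof -
    have "sat T \<alpha> (\<lambda>k. if k \<in> set ns then g k else e k) (foldr Conj Fs (Eq Zero Zero))
          \<and> g ` set ns \<subseteq> T
        \<longleftrightarrow> labelled_partition T \<alpha> \<phi> V (\<lambda>v. g (2 * i v))" for g
    proof -
      define E where "E = (\<lambda>k. if k \<in> set ns then g k else e k)"
      have x: "trm_val \<alpha> E (x v) = g (2 * i v)" if "v \<in> pverts V" for v
        using that vs by (auto simp: x_def E_def ns_def)
      \<comment> \<open>Parity keeps the quantified variables apart from the parameters.\<close>
      have "Suc (2 * m) \<notin> set ns" for m unfolding ns_def by (auto simp: Suc_double_not_eq_double)
      then have y: "trm_val \<alpha> E (y v) = \<phi> v" if "v \<in> pverts V" for v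
        using that e\<phi> by (auto simp: y_def E_def)
      have lit: "sat T \<alpha> E (lit b F) \<longleftrightarrow> (b \<longleftrightarrow> \<not> sat T \<alpha> E F)" for b F
        by (auto simp: lit_def)
      have im: "trm_val \<alpha> E ` x ` pverts V = (\<lambda>v. g (2 * i v)) ` pverts V"
        using x by (auto simp: image_image)
      have "set ns = (\<lambda>v. 2 * i v) ` pverts V" using vs by (auto simp: ns_def)
      then have carrier: "g ` set ns \<subseteq> T \<longleftrightarrow> (\<lambda>v. g (2 * i v)) ` pverts V \<subseteq> T" by (auto simp: image_image)
      have formula: "sat T \<alpha> E (foldr Conj Fs (Eq Zero Zero)) \<longleftrightarrow>
         Sup_fin (insert bot ((\<lambda>v. g (2 * i v)) ` pverts V)) = top
         \<and> (\<forall>v\<in>pverts V. g (2 * i v) \<noteq> bot) \<and> (\<forall>v\<in>pverts V. g (2 * i v) \<le> \<phi> v)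
         \<and> (\<forall>v\<in>pverts V. \<forall>w\<in>pverts V. v \<noteq> w \<longrightarrow> inf (g (2 * i v)) (g (2 * i w)) = bot)
         \<and> (\<forall>v\<in>pverts V. \<forall>w\<in>pverts V.
               (v, w) \<in> parcs V \<longleftrightarrow> inf (\<alpha> (g (2 * i v))) (g (2 * i w)) \<noteq> bot)"
      proof -
        have 1: "sat T \<alpha> E (Eq (foldr Join (map x vs) Zero) One) \<longleftrightarrow>
            Sup_fin (insert bot ((\<lambda>v. g (2 * i v)) ` pverts V)) = top"
          by (simp add: trm_val_foldr_Join vs im)
        have 2: "(\<forall>F\<in>set (map (\<lambda>v. Neg (Eq (x v) Zero)) vs). sat T \<alpha> E F) \<longleftrightarrow>
            (\<forall>v\<in>pverts V. g (2 * i v) \<noteq> bot)"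
          by (simp add: vs x)
        have 3: "(\<forall>F\<in>set (map (\<lambda>v. Leq (x v) (y v)) vs). sat T \<alpha> E F) \<longleftrightarrow>
            (\<forall>v\<in>pverts V. g (2 * i v) \<le> \<phi> v)"
          by (simp add: vs x y)
        have 4: "(\<forall>F\<in>set (map (\<lambda>(v, w). Eq (Meet (x v) (x w)) Zero)
              (filter (\<lambda>(v, w). v \<noteq> w) (List.product vs vs))). sat T \<alpha> E F) \<longleftrightarrow>
            (\<forall>v\<in>pverts V. \<forall>w\<in>pverts V. v \<noteq> w \<longrightarrow> inf (g (2 * i v)) (g (2 * i w)) = bot)"
          unfolding set_map ball_simps set_filter set_product vs by (auto simp: x)
        have 5: "(\<forall>F\<in>set (map (\<lambda>(v, w). lit ((v, w) \<in> parcs V) (Eq (Meet (Aut (x v)) (x w)) Zero))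
              (List.product vs vs)). sat T \<alpha> E F) \<longleftrightarrow>
            (\<forall>v\<in>pverts V. \<forall>w\<in>pverts V.
               (v, w) \<in> parcs V \<longleftrightarrow> inf (\<alpha> (g (2 * i v))) (g (2 * i w)) \<noteq> bot)"
          unfolding set_map ball_simps set_product vs by (auto simp: x lit)
        show ?thesis
          unfolding sat_foldr_Conj Fs_def list.set(2) set_append ball_simps ball_Un 1 2 3 4 5 ..
      qed
      show ?thesis
        unfolding E_def[symmetric] labelled_partition_def ball_conj_distrib carrier formula
        by (simp only: conj_ac)
    qed
    then show ?thesis unfolding sat_foldr_Exi by blast
  qed
  \<comment> \<open>\<open>f\<close> becomes an assignment to the even variables by decoding
    \<open>2 * i v\<close> to \<open>v\<close>.\<close>
  have "labelled_partition UNIV \<alpha> \<phi> V (\<lambda>v. (f \<circ> inv_into (pverts V) i \<circ> (\<lambda>k. k div 2)) (2 * i v))"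
  proof -
    have *: "(f \<circ> inv_into (pverts V) i \<circ> (\<lambda>k. k div 2)) (2 * i v) = f v" if "v \<in> pverts V" for v
      using i that by simp
    then have "(\<lambda>v. (f \<circ> inv_into (pverts V) i \<circ> (\<lambda>k. k div 2)) (2 * i v)) ` pverts V = f ` pverts V"
      by (auto simp: image_iff)
    with * f show ?thesis unfolding labelled_partition_def by simp
  qed
  then have "\<exists>g. labelled_partition UNIV \<alpha> \<phi> V (\<lambda>v. g (2 * i v))" by blast
  then have "\<exists>g. labelled_partition S \<alpha> \<phi> V (\<lambda>v. g (2 * i v))"
    unfolding key[symmetric] sat .
  then show thesis using that by blast
qed


section \<open>Sequences and the digraphs of their recurrent transitions\<close>

text \<open>For \<open>x\<close> of finite range this is, up to isomorphism, the digraph of the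
  partition of \<open>\<P>(\<omega>)/Fin\<close> into the classes of the fibres of \<open>x\<close>:
  "infinitely often" expresses being nonzero modulo finite sets.\<close>

definition limit_digraph :: "(nat \<Rightarrow> 'v) \<Rightarrow> 'v pair_pre_digraph" where
  "limit_digraph x = \<lparr>pverts = {v. \<exists>\<^sub>\<infinity>n. x n = v}, parcs = {(v, w). \<exists>\<^sub>\<infinity>n. x n = v \<and> x (Suc n) = w}\<rparr>"

lemma abs_pfin_eq_bot_iff: "abs_pfin A = bot \<longleftrightarrow> finite A"
  by (simp add: bot_pfin_def pfin.abs_eq_iff)

lemma abs_pfin_eq_top_iff: "abs_pfin A = top \<longleftrightarrow> finite (- A)"
  by (simp add: top_pfin_def pfin.abs_eq_iff Compl_eq_Diff_UNIV)

lemma Sup_fin_abs_pfin: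
  assumes "finite F"
  shows "Sup_fin (insert bot ((\<lambda>v. abs_pfin (A v)) ` F)) = abs_pfin (\<Union>v\<in>F. A v)"
  using assms
proof induction
  case (insert v F)
  have "Sup_fin (insert (abs_pfin (A v)) (insert bot ((\<lambda>v. abs_pfin (A v)) ` F)))
      = sup (abs_pfin (A v)) (Sup_fin (insert bot ((\<lambda>v. abs_pfin (A v)) ` F)))"
    using insert by (intro Sup_fin.insert) auto
  with insert show ?case by (simp add: insert_commute sup_pfin.abs_eq)
qed (simp add: bot_pfin_def)

lemma infm_value:
  assumes "finite (range x)" "\<exists>\<^sub>\<infinity>n. Q n"
  obtains v where "\<exists>\<^sub>\<infinity>n. x n = v \<and> Q n"
proof -
  have "infinite {n. Q n}" using assms(2) by (simp add: INFM_iff_infinite)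
  moreover have "finite (x ` {n. Q n})" using assms(1) by (rule rev_finite_subset) auto
  ultimately obtain m where "infinite {n \<in> {n. Q n}. x n = x m}"
    using pigeonhole_infinite by blast
  then have "\<exists>\<^sub>\<infinity>n. x n = x m \<and> Q n" by (simp add: INFM_iff_infinite conj_commute)
  then show thesis using that by blast
qed

lemma limit_digraph_fin:
  assumes "finite (range x)"
  shows "pair_fin_digraph (limit_digraph x)"
proof -
  have *: "pverts (limit_digraph x) \<subseteq> range x"
    by (auto simp: limit_digraph_def dest!: INFM_EX)
  have **: "parcs (limit_digraph x) \<subseteq> range x \<times> range x"
    by (auto simp: limit_digraph_def dest!: INFM_EX)
  show ?thesis
  proof
    show "fst e \<in> pverts (limit_digraph x)" if "e \<in> parcs (limit_digraph x)" for e
      using that by (auto simp: limit_digraph_def elim: INFM_mono)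
    show "snd e \<in> pverts (limit_digraph x)" if e: "e \<in> parcs (limit_digraph x)" for e
    proof -
      have "\<exists>\<^sub>\<infinity>n. x (Suc n) = snd e"
        using e by (auto simp: limit_digraph_def elim: INFM_mono)
      then have "\<exists>\<^sub>\<infinity>n. x n = snd e"
        unfolding INFM_nat by (meson less_SucI)
      then show ?thesis by (simp add: limit_digraph_def)
    qed
  qed (use assms finite_subset[OF *] finite_subset[OF **] in auto)
qed

text \<open>Only finitely many pairs of consecutive values exist, and each one that is not an arc
  occurs finitely often.\<close>

lemma limit_digraph_eventually:
  assumes "finite (range x)"
  shows "\<forall>\<^sub>\<infinity>n. x n \<in> pverts (limit_digraph x) \<and> (x n, x (Suc n)) \<in> parcs (limit_digraph x)"
proof -
  have r: "finite (range (\<lambda>n. (x n, x (Suc n))))"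
    by (rule finite_subset[of _ "range x \<times> range x"]) (use assms in auto)
  have "\<forall>\<^sub>\<infinity>n. (x n, x (Suc n)) \<in> parcs (limit_digraph x)"
  proof (rule ccontr)
    assume "\<not> ?thesis"
    then have "\<exists>\<^sub>\<infinity>n. (x n, x (Suc n)) \<notin> parcs (limit_digraph x)" by simp
    from infm_value[OF r this] obtain vw where
      vw: "\<exists>\<^sub>\<infinity>n. (x n, x (Suc n)) = vw \<and> (x n, x (Suc n)) \<notin> parcs (limit_digraph x)" by blast
    then have "vw \<notin> parcs (limit_digraph x)" by (auto dest!: INFM_EX)
    moreover have "vw \<in> parcs (limit_digraph x)"
      using vw by (cases vw) (auto simp: limit_digraph_def elim: INFM_mono)
    ultimately show False by blast
  qed
  then show ?thesis
    by (rule MOST_mono)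
      (use pair_wf_digraph.in_arcsD1 limit_digraph_fin[OF assms] in
        \<open>auto simp: pair_fin_digraph_def dest: pair_wf_digraph.in_arcsD1\<close>)
qed

text \<open>Beyond some point \<open>x\<close> itself is a walk in the digraph, and it returns to
  each vertex infinitely often, so every visit to \<open>v\<close> is followed by a visit to
  \<open>w\<close>.\<close>

lemma limit_digraph_strongly_connected:
  assumes "finite (range x)"
  shows "strongly_connected (with_proj (limit_digraph x))"
proof -
  let ?L = "limit_digraph x"
  obtain N where N: "\<And>n. n \<ge> N \<Longrightarrow> x n \<in> pverts ?L \<and> (x n, x (Suc n)) \<in> parcs ?L"
    using limit_digraph_eventually[OF assms] by (auto simp: MOST_nat_le)
  have path: "(x n, x (n + k)) \<in> rtrancl_on (pverts ?L) (parcs ?L)" if "n \<ge> N" for n k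
  proof (induction k)
    case 0 then show ?case using N that by simp
  next
    case (Suc k)
    then show ?case using N[of "n + k"] N[of "Suc (n + k)"] that
      by (auto intro: rtrancl_on_into_rtrancl_on)
  qed
  have "(v, w) \<in> rtrancl_on (pverts ?L) (parcs ?L)" if "v \<in> pverts ?L" "w \<in> pverts ?L" for v w
  proof -
    have "\<forall>m. \<exists>n\<ge>m. x n = v" "\<forall>m. \<exists>n\<ge>m. x n = w"
      using that by (auto simp: limit_digraph_def INFM_nat_le)
    then obtain n m where "n \<ge> N" "x n = v" "m \<ge> n" "x m = w" by metis
    then show ?thesis using path[of n "m - n"] by simp
  qed
  then show ?thesis using N by (auto simp: strongly_connected_def reachable_def)
qed

text \<open>Almost all \<open>n\<close> lie in the fibre of a recurrent value, so the join is
  \<open>top\<close>; agreement of \<open>\<phi> (x n)\<close> with \<open>c n\<close> for almost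
  all \<open>n\<close> puts the fibre of \<open>v\<close> below \<open>\<phi> v\<close>.\<close>

lemma labelled_partition_limit_digraph:
  fixes x :: "nat \<Rightarrow> 'v" and c :: "nat \<Rightarrow> pfin"
  assumes x: "finite (range x)" and c: "\<And>a. a \<in> P \<Longrightarrow> abs_pfin {n. c n = a} = a"
    and P: "\<phi> ` pverts (limit_digraph x) \<subseteq> P" and \<phi>: "\<forall>\<^sub>\<infinity>n. \<phi> (x n) = c n"
  shows "labelled_partition UNIV shift \<phi> (limit_digraph x) (\<lambda>v. abs_pfin {n. x n = v})"
  unfolding labelled_partition_def
proof (intro conjI ballI impI)
  let ?L = "limit_digraph x"
  have fin: "finite (pverts ?L)"
    using limit_digraph_fin[OF x] by (simp add: pair_fin_digraph_def pair_fin_digraph_axioms_def)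
  show "Sup_fin (insert bot ((\<lambda>v. abs_pfin {n. x n = v}) ` pverts ?L)) = top"
    unfolding Sup_fin_abs_pfin[OF fin] abs_pfin_eq_top_iff
    using limit_digraph_eventually[OF x] unfolding eventually_cofinite
    by (rule rev_finite_subset) auto
  fix v assume v: "v \<in> pverts ?L"
  then show "abs_pfin {n. x n = v} \<noteq> bot"
    by (simp add: abs_pfin_eq_bot_iff limit_digraph_def INFM_iff_infinite)
  have "abs_pfin {n. x n = v} \<le> abs_pfin {n. c n = \<phi> v}"
    unfolding less_eq_pfin.abs_eq using \<phi> unfolding eventually_cofinite
    by (rule rev_finite_subset) auto
  then show "abs_pfin {n. x n = v} \<le> \<phi> v" using c P v by auto
  fix w assume w: "w \<in> pverts ?L"
  show "inf (abs_pfin {n. x n = v}) (abs_pfin {n. x n = w}) = bot" if "v \<noteq> w"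
    using that by (auto simp: inf_pfin.abs_eq abs_pfin_eq_bot_iff intro: finite_subset[of _ "{}"])
  \<comment> \<open>\<open>shift\<close> moves the fibre of \<open>v\<close> up by one, so the meet
    consists of the arrival times of the transitions from \<open>v\<close> to
    \<open>w\<close>.\<close>
  have "Suc ` {n. x n = v} \<inter> {n. x n = w} = Suc ` {n. x n = v \<and> x (Suc n) = w}" by auto
  then show "(v, w) \<in> parcs ?L \<longleftrightarrow>
      inf (shift (abs_pfin {n. x n = v})) (abs_pfin {n. x n = w}) \<noteq> bot"
    by (simp add: shift.abs_eq inf_pfin.abs_eq abs_pfin_eq_bot_iff limit_digraph_def
        INFM_iff_infinite finite_image_iff)
qed simp

text \<open>Representatives of the members partition the natural numbers up to finitely many errors;
  elsewhere \<open>c n\<close> names the representative containing \<open>n\<close>.\<close>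

lemma partition_sequence:
  assumes P: "ba_partition S P"
  obtains c where "range c \<subseteq> P" "\<And>a. a \<in> P \<Longrightarrow> abs_pfin {n. c n = a} = a"
proof -
  have fin: "finite P" using P by (simp add: ba_partition_def)
  have rep: "abs_pfin (rep_pfin a) = a" for a by (rule Quotient_abs_rep[OF Quotient_pfin])
  \<comment> \<open>The errors: points in two representatives or in none.\<close>
  define B where "B = (\<Union>a\<in>P. \<Union>b\<in>P - {a}. rep_pfin a \<inter> rep_pfin b) \<union> - (\<Union>a\<in>P. rep_pfin a)"
  have "finite (rep_pfin a \<inter> rep_pfin b)" if "a \<in> P" "b \<in> P" "b \<noteq> a" for a b
  proof -
    have "inf (abs_pfin (rep_pfin a)) (abs_pfin (rep_pfin b)) = bot"
      using P that by (auto simp: rep ba_partition_def pairwise_def)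
    then show ?thesis by (simp add: inf_pfin.abs_eq abs_pfin_eq_bot_iff)
  qed
  moreover have "finite (- (\<Union>a\<in>P. rep_pfin a))"
  proof -
    have "abs_pfin (\<Union>a\<in>P. rep_pfin a) = Sup_fin (insert bot P)"
      unfolding Sup_fin_abs_pfin[OF fin, symmetric] rep by simp
    also have "\<dots> = top" using P by (simp add: ba_partition_def)
    finally show ?thesis by (simp only: abs_pfin_eq_top_iff)
  qed
  ultimately have B: "finite B" unfolding B_def using fin by (intro finite_UnI finite_UN_I) auto
  \<comment> \<open>On \<open>B\<close> the value of \<open>c\<close> is an arbitrary member, so one
    must exist; it does because \<open>bot\<close> and \<open>top\<close> differ in
    \<open>pfin\<close>.\<close>
  have "P \<noteq> {}"
  proof
    assume "P = {}"
    then have "(bot :: pfin) = top" using P by (simp add: ba_partition_def)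
    then show False by (simp add: bot_pfin_def abs_pfin_eq_top_iff)
  qed
  have "\<exists>a\<in>P. n \<notin> B \<longrightarrow> n \<in> rep_pfin a" for n using \<open>P \<noteq> {}\<close> by (auto simp: B_def)
  then obtain c where c: "\<And>n. c n \<in> P" "\<And>n. n \<notin> B \<Longrightarrow> n \<in> rep_pfin (c n)" by metis
  have "abs_pfin {n. c n = a} = a" if a: "a \<in> P" for a
  proof -
    have "n \<in> rep_pfin a \<longleftrightarrow> c n = a" if "n \<notin> B" for n
    proof
      assume n: "n \<in> rep_pfin a"
      show "c n = a"
      proof (rule ccontr)
        assume "c n \<noteq> a"
        then have "n \<in> B" unfolding B_def using a n c(1)[of n] c(2)[OF that] by blast
        with that show False by blast
      qed
    qed (use c(2)[OF that] in blast)
    then have "finite (({n. c n = a} - rep_pfin a) \<union> (rep_pfin a - {n. c n = a}))"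
      by (intro finite_subset[OF _ B]) auto
    then have "abs_pfin {n. c n = a} = abs_pfin (rep_pfin a)" by (simp add: pfin.abs_eq_iff)
    then show ?thesis by (simp add: rep)
  qed
  with c show thesis using that by blast
qed


section \<open>Types of lifts\<close>

text \<open>The arcs are recorded without order or multiplicity, so for finite \<open>V\<close> the
  possible types for \<open>m \<le> n\<close> do not grow with the length of the interval.\<close>

definition lift_type :: "'v pair_pre_digraph \<Rightarrow> ('v \<Rightarrow> 'a) \<Rightarrow> (nat \<Rightarrow> 'a) \<Rightarrow> nat \<Rightarrow> nat
    \<Rightarrow> ('v \<times> ('v \<times> 'v) set \<times> 'v) set" where
  "lift_type V \<phi> c m n = {(y m, (\<lambda>k. (y k, y (Suc k))) ` {m..<n}, y n) | y.
     (\<forall>k\<in>{m..n}. y k \<in> pverts V \<and> \<phi> (y k) = c k) \<and> (\<forall>k\<in>{m..<n}. (y k, y (Suc k)) \<in> parcs V)}"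

text \<open>The transition function of a deterministic automaton that reads \<open>c\<close>: by
  \<open>lift_type_Suc\<close>, the type of an interval and the next colour determine the type of
  the interval longer by one.\<close>

definition extend_type :: "'v pair_pre_digraph \<Rightarrow> ('v \<Rightarrow> 'a) \<Rightarrow> 'a
    \<Rightarrow> ('v \<times> ('v \<times> 'v) set \<times> 'v) set \<Rightarrow> ('v \<times> ('v \<times> 'v) set \<times> 'v) set" where
  "extend_type V \<phi> a t = {(u, insert (v, w) E, w) | u E v w.
     (u, E, v) \<in> t \<and> w \<in> pverts V \<and> \<phi> w = a \<and> (v, w) \<in> parcs V}"

lemma lift_type_refl: "lift_type V \<phi> c n n = {(v, {}, v) | v. v \<in> pverts V \<and> \<phi> v = c n}"
  unfolding lift_type_def by auto

text \<open>Lifts that agree at the common end point \<open>n\<close> concatenate, and their arc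
  sets unite because \<open>{m..<n}\<close> and \<open>{n..<p}\<close> make up
  \<open>{m..<p}\<close>.\<close>

lemma lift_type_trans:
  assumes "m \<le> n" "n \<le> p" "(u, E, v) \<in> lift_type V \<phi> c m n" "(v, F, w) \<in> lift_type V \<phi> c n p"
  shows "(u, E \<union> F, w) \<in> lift_type V \<phi> c m p"
proof -
  obtain y where y: "u = y m" "E = (\<lambda>k. (y k, y (Suc k))) ` {m..<n}" "v = y n"
     "\<forall>k\<in>{m..n}. y k \<in> pverts V \<and> \<phi> (y k) = c k" "\<forall>k\<in>{m..<n}. (y k, y (Suc k)) \<in> parcs V"
    using assms(3) unfolding lift_type_def by blast
  obtain z where z: "v = z n" "F = (\<lambda>k. (z k, z (Suc k))) ` {n..<p}" "w = z p"
     "\<forall>k\<in>{n..p}. z k \<in> pverts V \<and> \<phi> (z k) = c k" "\<forall>k\<in>{n..<p}. (z k, z (Suc k)) \<in> parcs V"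
    using assms(4) unfolding lift_type_def by blast
  define x where "x = (\<lambda>k. if k \<le> n then y k else z k)"
  have xy: "x k = y k" if "k \<le> n" for k using that by (simp add: x_def)
  have xz: "x k = z k" if "n \<le> k" for k using that y(3) z(1) by (auto simp: x_def)
  have "(\<lambda>k. (x k, x (Suc k))) ` {m..<n} = E" unfolding y(2) by (intro image_cong) (auto simp: xy)
  moreover have "(\<lambda>k. (x k, x (Suc k))) ` {n..<p} = F"
    unfolding z(2) by (intro image_cong) (auto simp: xz)
  ultimately have "(\<lambda>k. (x k, x (Suc k))) ` {m..<p} = E \<union> F"
    by (simp add: ivl_disj_un_two(3)[OF assms(1,2), symmetric] image_Un)
  moreover have "\<forall>k\<in>{m..p}. x k \<in> pverts V \<and> \<phi> (x k) = c k"
    using y(4) z(4) by (auto simp: x_def)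
  moreover have "\<forall>k\<in>{m..<p}. (x k, x (Suc k)) \<in> parcs V"
  proof
    fix k assume "k \<in> {m..<p}"
    then show "(x k, x (Suc k)) \<in> parcs V" using y(5) z(5) xy xz by (cases "k < n") auto
  qed
  moreover have "x m = u" "x p = w" using assms y z by (auto simp: xy xz)
  ultimately show ?thesis unfolding lift_type_def by blast
qed

lemma lift_type_Suc_single:
  assumes "v \<in> pverts V" "w \<in> pverts V" "(v, w) \<in> parcs V" "\<phi> v = c n" "\<phi> w = c (Suc n)"
  shows "(v, {(v, w)}, w) \<in> lift_type V \<phi> c n (Suc n)"
  unfolding lift_type_def
  by (intro CollectI exI[of _ "\<lambda>k. if k \<le> n then v else w"])
    (use assms in \<open>auto simp: le_Suc_eq atLeastLessThanSuc\<close>)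

lemma lift_type_target:
  assumes "(u, E, v) \<in> lift_type V \<phi> c m n" "m \<le> n"
  shows "v \<in> pverts V" "\<phi> v = c n"
  using assms by (auto simp: lift_type_def)

lemma lift_type_Suc:
  assumes "m \<le> n"
  shows "lift_type V \<phi> c m (Suc n) = extend_type V \<phi> (c (Suc n)) (lift_type V \<phi> c m n)"
proof (intro set_eqI iffI)
  fix t assume "t \<in> lift_type V \<phi> c m (Suc n)"
  then obtain y where y: "t = (y m, (\<lambda>k. (y k, y (Suc k))) ` {m..<Suc n}, y (Suc n))"
     "\<forall>k\<in>{m..Suc n}. y k \<in> pverts V \<and> \<phi> (y k) = c k"
     "\<forall>k\<in>{m..<Suc n}. (y k, y (Suc k)) \<in> parcs V"
    unfolding lift_type_def by blast
  have "(y m, (\<lambda>k. (y k, y (Suc k))) ` {m..<n}, y n) \<in> lift_type V \<phi> c m n"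
    unfolding lift_type_def using y(2,3) by (intro CollectI exI[of _ y]) auto
  moreover have "t = (y m, insert (y n, y (Suc n)) ((\<lambda>k. (y k, y (Suc k))) ` {m..<n}), y (Suc n))"
    using assms unfolding y(1) by (simp add: atLeastLessThanSuc)
  moreover have "y (Suc n) \<in> pverts V" "\<phi> (y (Suc n)) = c (Suc n)" "(y n, y (Suc n)) \<in> parcs V"
    using y(2,3) assms by auto
  ultimately show "t \<in> extend_type V \<phi> (c (Suc n)) (lift_type V \<phi> c m n)"
    unfolding extend_type_def by blast
next
  fix t assume "t \<in> extend_type V \<phi> (c (Suc n)) (lift_type V \<phi> c m n)"
  then obtain u E v w where t: "t = (u, insert (v, w) E, w)" "(u, E, v) \<in> lift_type V \<phi> c m n"
     "w \<in> pverts V" "\<phi> w = c (Suc n)" "(v, w) \<in> parcs V"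
    unfolding extend_type_def by blast
  then have "(v, {(v, w)}, w) \<in> lift_type V \<phi> c n (Suc n)"
    using lift_type_target[OF t(2) assms] by (intro lift_type_Suc_single) auto
  from lift_type_trans[OF assms _ t(2) this] t(1) show "t \<in> lift_type V \<phi> c m (Suc n)" by simp
qed

text \<open>As \<open>m \<le> n\<close>, the constraints on \<open>y\<close> cover both end points
  and all arcs, so each type is a subset of one finite set.\<close>

lemma finite_lift_types:
  assumes "finite (pverts V)"
  shows "finite {lift_type V \<phi> c m n | m n. m \<le> n}"
proof (rule finite_subset)
  show "{lift_type V \<phi> c m n | m n. m \<le> n} \<subseteq>
      Pow (pverts V \<times> Pow (pverts V \<times> pverts V) \<times> pverts V)"
    by (auto simp: lift_type_def image_subset_iff)
qed (use assms in auto)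

section \<open>Gluing lifts along an increasing sequence\<close>

lemma strict_mono_interval:
  fixes r :: "nat \<Rightarrow> nat"
  assumes "strict_mono r"
  obtains i where "\<And>n. r 0 \<le> n \<Longrightarrow> r (i n) \<le> n" "\<And>n. n < r (Suc (i n))"
    "\<And>j n. r j \<le> n \<Longrightarrow> n < r (Suc j) \<Longrightarrow> i n = j"
proof -
  \<comment> \<open>The index of the block of \<open>r\<close> that contains \<open>n\<close>. Below
    \<open>r 0\<close> it is 0, hence the assumption \<open>r 0 \<le> n\<close> in the lower
    bound.\<close>
  define i where "i = (\<lambda>n. LEAST j. n < r (Suc j))"
  have less: "n < r (Suc (i n))" for n
  proof -
    have "n < r (Suc n)" using strict_mono_imp_increasing[OF assms, of "Suc n"] by simp
    then show ?thesis unfolding i_def by (rule LeastI[where P = "\<lambda>j. n < r (Suc j)"])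
  qed
  have ge: "r (i n) \<le> n" if "r 0 \<le> n" for n
  proof (cases "i n")
    case (Suc j)
    then have "\<not> n < r (Suc j)" unfolding i_def using not_less_Least[of j "\<lambda>j. n < r (Suc j)"] by simp
    then show ?thesis using Suc by simp
  qed (use that in simp)
  have "i n = j" if "r j \<le> n" "n < r (Suc j)" for j n
    unfolding i_def
  proof (rule Least_equality)
    fix k assume "n < r (Suc k)"
    then have "r j < r (Suc k)" using that by simp
    then show "j \<le> k" using assms by (simp add: strict_mono_less)
  qed (fact that)
  with less ge show thesis using that by blast
qed

text \<open>On each block there is a lift from \<open>v\<close> to \<open>v\<close> that uses
  exactly the arcs of \<open>V\<close>. Consecutive lifts fit together at \<open>v\<close>, and the
  glued sequence makes every arc of \<open>V\<close> infinitely often and no other transition from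
  \<open>r 0\<close> on. The outgoing arcs ensure that every vertex recurs.\<close>

lemma lift_sequence:
  assumes r: "strict_mono r"
    and lift: "\<And>i. (v, parcs V, v) \<in> lift_type V \<phi> c (r i) (r (Suc i))"
    and V: "pair_fin_digraph V" "\<And>u. u \<in> pverts V \<Longrightarrow> \<exists>w. (u, w) \<in> parcs V"
  obtains x where "finite (range x)" "limit_digraph x = V" "\<forall>\<^sub>\<infinity>n. \<phi> (x n) = c n"
proof -
  have "\<forall>i. \<exists>y. v = y (r i) \<and> parcs V = (\<lambda>k. (y k, y (Suc k))) ` {r i..<r (Suc i)} \<and> v = y (r (Suc i))
      \<and> (\<forall>k\<in>{r i..r (Suc i)}. y k \<in> pverts V \<and> \<phi> (y k) = c k)"
    using lift unfolding lift_type_def by blast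
  then obtain y where y: "\<And>i. y i (r i) = v" "\<And>i. y i (r (Suc i)) = v"
    "\<And>i. parcs V = (\<lambda>k. (y i k, y i (Suc k))) ` {r i..<r (Suc i)}"
    "\<And>i k. k \<in> {r i..r (Suc i)} \<Longrightarrow> y i k \<in> pverts V \<and> \<phi> (y i k) = c k"
    by metis
  obtain i where i: "\<And>n. r 0 \<le> n \<Longrightarrow> r (i n) \<le> n" "\<And>n. n < r (Suc (i n))"
    "\<And>j n. r j \<le> n \<Longrightarrow> n < r (Suc j) \<Longrightarrow> i n = j"
    using strict_mono_interval[OF r] by blast
  define x where "x = (\<lambda>n. y (i n) n)"
  \<comment> \<open>The right end \<open>r (Suc j)\<close> already belongs to the next block, but
    both lifts take the value \<open>v\<close> there.\<close>
  have x: "x n = y j n" if "n \<in> {r j..r (Suc j)}" for n j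
  proof (cases "n = r (Suc j)")
    case True
    have "r (Suc j) < r (Suc (Suc j))" using r by (simp add: strict_mono_less)
    then have "i n = Suc j" using True by (intro i(3)) auto
    then show ?thesis using y(1,2) True by (simp add: x_def)
  next
    case False
    then show ?thesis using that i(3)[of j n] by (simp add: x_def)
  qed
  have large: "x n \<in> pverts V \<and> \<phi> (x n) = c n \<and> (x n, x (Suc n)) \<in> parcs V" if "r 0 \<le> n" for n
  proof -
    have n: "n \<in> {r (i n)..<r (Suc (i n))}" using i(1)[OF that] i(2) by simp
    then have "x n = y (i n) n" "x (Suc n) = y (i n) (Suc n)" by (auto intro!: x)
    moreover have "(y (i n) n, y (i n) (Suc n)) \<in> parcs V" using y(3)[of "i n"] n by blast
    ultimately show ?thesis using y(4)[of n "i n"] n by simp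
  qed
  \<comment> \<open>The block numbered \<open>m\<close> uses the arc at some time \<open>k\<close>,
    and \<open>k\<close> is at least \<open>r m\<close>, hence at least \<open>m\<close>.\<close>
  have often: "\<exists>\<^sub>\<infinity>n. x n = u \<and> x (Suc n) = w" if uw: "(u, w) \<in> parcs V" for u w
    unfolding INFM_nat_le
  proof
    fix m
    obtain k where k: "k \<in> {r m..<r (Suc m)}" "u = y m k" "w = y m (Suc k)"
      using uw y(3)[of m] by blast
    then have "x k = u" "x (Suc k) = w" by (auto intro!: x)
    moreover have "m \<le> k" using k(1) strict_mono_imp_increasing[OF r, of m] by simp
    ultimately show "\<exists>n\<ge>m. x n = u \<and> x (Suc n) = w" by blast
  qed
  have fin: "finite (pverts V)" using V(1)
    by (simp add: pair_fin_digraph_def pair_fin_digraph_axioms_def)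
  have "range x \<subseteq> x ` {..<r 0} \<union> pverts V"
    using large by (auto simp: not_le) (meson image_eqI lessThan_iff not_le)
  then have "finite (range x)" using fin finite_subset by blast
  moreover have "pverts (limit_digraph x) = pverts V"
  proof (intro set_eqI iffI)
    fix u assume "u \<in> pverts V"
    then obtain w where "(u, w) \<in> parcs V" using V(2) by blast
    from often[OF this] show "u \<in> pverts (limit_digraph x)"
      by (auto simp: limit_digraph_def elim: INFM_mono)
  next
    fix u assume "u \<in> pverts (limit_digraph x)"
    then obtain n where "r 0 \<le> n" "x n = u" by (auto simp: limit_digraph_def INFM_nat_le)
    then show "u \<in> pverts V" using large by blast
  qed
  moreover have "parcs (limit_digraph x) = parcs V"
  proof (intro set_eqI iffI)
    fix e assume "e \<in> parcs V"
    then show "e \<in> parcs (limit_digraph x)" using often by (cases e) (auto simp: limit_digraph_def)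
  next
    fix e assume "e \<in> parcs (limit_digraph x)"
    then obtain n where "r 0 \<le> n" "(x n, x (Suc n)) = e"
      by (cases e) (auto simp: limit_digraph_def INFM_nat_le)
    then show "e \<in> parcs V" using large by blast
  qed
  moreover have "\<forall>\<^sub>\<infinity>n. \<phi> (x n) = c n" using large unfolding MOST_nat_le by blast
  ultimately show thesis using that[of x] by (simp add: pair_pre_digraph.equality)
qed

section \<open>A sequence homogeneous for lift types\<close>

lemma ramsey_lift_type:
  assumes "finite (pverts V)"
  obtains r :: "nat \<Rightarrow> nat" and t where "strict_mono r"
    "\<forall>i j. i < j \<longrightarrow> lift_type V \<phi> c (r i) (r j) = t"
proof -
  let ?T = "{lift_type V \<phi> c m n | m n. m \<le> n}"
  obtain code :: "_ \<Rightarrow> nat" and s where code: "inj_on code ?T" "code ` ?T = {i. i < s}"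
    using finite_imp_inj_to_nat_seg[OF finite_lift_types[OF assms, of \<phi> c]] by blast
  have bound: "code (lift_type V \<phi> c m n) < s" if "m \<le> n" for m n
    using code(2) that by blast
  \<comment> \<open>The colour of a pair is the code of the type of the interval between its
    elements; \<open>Min\<close> and \<open>Max\<close> restore the order that a two-element set
    forgets.\<close>
  obtain Y k where Y: "infinite Y" and k: "\<forall>m\<in>Y. \<forall>n\<in>Y. m \<noteq> n \<longrightarrow>
      code (lift_type V \<phi> c (Min {m, n}) (Max {m, n})) = k"
    using Ramsey2[of "UNIV :: nat set" "\<lambda>X. code (lift_type V \<phi> c (Min X) (Max X))" s] bound
    by auto
  define r where "r = enumerate Y"
  have r: "strict_mono r" "\<And>i. r i \<in> Y"
    unfolding r_def using strict_mono_enumerate[OF Y] enumerate_in_set[OF Y] by blast+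
  have "lift_type V \<phi> c (r i) (r j) = lift_type V \<phi> c (r 0) (r 1)" if "i < j" for i j
  proof (rule inj_onD[OF code(1)])
    have less: "r i < r j" if "i < j" for i j using r(1) that by (simp add: strict_mono_less)
    have k': "code (lift_type V \<phi> c (r i) (r j)) = k" if "i < j" for i j
    proof -
      have "Min {r i, r j} = r i" "Max {r i, r j} = r j" using less[OF that] by auto
      moreover have "code (lift_type V \<phi> c (Min {r i, r j}) (Max {r i, r j})) = k"
        by (rule k[rule_format]) (use r(2) less[OF that] in auto)
      ultimately show ?thesis by simp
    qed
    show "code (lift_type V \<phi> c (r i) (r j)) = code (lift_type V \<phi> c (r 0) (r 1))"
      using k'[OF that] k'[of 0 1] by simp
    have "r i \<le> r j" "r 0 \<le> r 1" using less[OF that] less[of 0 1] by auto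
    then show "lift_type V \<phi> c (r i) (r j) \<in> ?T" "lift_type V \<phi> c (r 0) (r 1) \<in> ?T" by blast+
  qed
  with r(1) show thesis by (intro that[of r "lift_type V \<phi> c (r 0) (r 1)"]) blast+
qed

section \<open>Closed walks covering every arc\<close>

inductive walk_arcs :: "'w pair_pre_digraph \<Rightarrow> ('w \<Rightarrow> 'v) \<Rightarrow> 'w \<Rightarrow> ('v \<times> 'v) set \<Rightarrow> 'w \<Rightarrow> bool"
  for W k w0 where
  base: "walk_arcs W k w0 {} w0"
| step: "walk_arcs W k w0 E w \<Longrightarrow> (w, w') \<in> parcs W \<Longrightarrow> walk_arcs W k w0 (insert (k w, k w') E) w'"

lemma walk_arcs_reachable:
  assumes "(w, w') \<in> rtrancl_on (pverts W) (parcs W)" "walk_arcs W k w0 E w"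
  shows "\<exists>E'. E \<subseteq> E' \<and> walk_arcs W k w0 E' w'"
  using assms
proof (induct rule: rtrancl_on_induct)
  case (step x y)
  then obtain E' where "E \<subseteq> E'" "walk_arcs W k w0 E' x" by blast
  then have "E \<subseteq> insert (k x, k y) E'" "walk_arcs W k w0 (insert (k x, k y) E') y"
    using step.hyps by (auto intro: walk_arcs.step)
  then show ?case by blast
qed blast

lemma walk_arcs_subset:
  assumes "walk_arcs W k w0 E w" "digraph_epi k W V"
  shows "E \<subseteq> parcs V"
  using assms(1)
proof induct
  case (step E w w')
  have "w \<in> pverts W" "w' \<in> pverts W"
    using step(3) assms(2) pair_wf_digraph.in_arcsD1 pair_wf_digraph.in_arcsD2
    unfolding digraph_epi_def pair_fin_digraph_def by fastforce+
  then have "(k w, k w') \<in> parcs V" using assms(2) step(3) unfolding digraph_epi_def by blast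
  with step show ?case by simp
qed simp

text \<open>Induction over the finitely many arcs of \<open>V\<close>: a closed walk at
  \<open>w0\<close> is prolonged to the source of an arc of \<open>W\<close> above the new arc,
  through that arc, and back to \<open>w0\<close>.\<close>

lemma walk_arcs_covering:
  assumes W: "strongly_connected (with_proj W)" and k: "digraph_epi k W V" and w0: "w0 \<in> pverts W"
  shows "walk_arcs W k w0 (parcs V) w0"
proof -
  have reach: "(w, w') \<in> rtrancl_on (pverts W) (parcs W)" if "w \<in> pverts W" "w' \<in> pverts W" for w w'
    using W that by (auto simp: strongly_connected_def reachable_def)
  have fin: "finite (parcs V)" using k
    by (simp add: digraph_epi_def pair_fin_digraph_def pair_fin_digraph_axioms_def)
  have "\<exists>E. F \<subseteq> E \<and> walk_arcs W k w0 E w0" if "finite F" "F \<subseteq> parcs V" for F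
    using that
  proof induction
    case empty
    show ?case by (rule exI[of _ "{}"]) (simp add: walk_arcs.base)
  next
    case (insert e F)
    then obtain E where E: "F \<subseteq> E" "walk_arcs W k w0 E w0" by auto
    have V: "fst e \<in> pverts V" "snd e \<in> pverts V"
      using insert.prems k pair_wf_digraph.in_arcsD1 pair_wf_digraph.in_arcsD2
      unfolding digraph_epi_def pair_fin_digraph_def by (metis insert_subset prod.collapse)+
    then obtain w w' where w: "w \<in> pverts W" "w' \<in> pverts W" "k w = fst e" "k w' = snd e"
        "(w, w') \<in> parcs W"
      using insert.prems k unfolding digraph_epi_def by (metis insert_subset prod.collapse)
    obtain E1 where E1: "E \<subseteq> E1" "walk_arcs W k w0 E1 w"
      using walk_arcs_reachable[OF reach[OF w0 w(1)] E(2)] by blast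
    have "walk_arcs W k w0 (insert e E1) w'"
      using walk_arcs.step[OF E1(2) w(5)] w(3,4) by simp
    from walk_arcs_reachable[OF reach[OF w(2) w0] this] E E1 show ?case by blast
  qed
  from this[OF fin] walk_arcs_subset[OF _ k] show ?thesis by (metis order_antisym order_refl)
qed

text \<open>A path from \<open>u\<close> to the source of some arc either leaves \<open>u\<close> or
  is trivial, and then that arc starts at \<open>u\<close>. The nonempty arc set excludes a single
  vertex without a loop.\<close>

lemma strongly_connected_out_arc:
  assumes "strongly_connected (with_proj V)" "parcs V \<noteq> {}" "pair_wf_digraph V" "u \<in> pverts V"
  shows "\<exists>w. (u, w) \<in> parcs V"
proof -
  obtain a b where ab: "(a, b) \<in> parcs V" using assms(2) by auto
  then have "a \<in> pverts V" using pair_wf_digraph.in_arcsD1[OF assms(3)] by blast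
  then have "(u, a) \<in> rtrancl_on (pverts V) (parcs V)"
    using assms(1,4) by (auto simp: strongly_connected_def reachable_def)
  then show ?thesis
  proof (cases rule: converse_rtrancl_on_cases)
  qed (use ab in auto)
qed

lemma digraph_isom_strongly_connected:
  assumes "digraph_isom f V U" "strongly_connected (with_proj V)"
    "pair_wf_digraph V"
  shows "strongly_connected (with_proj U)"
proof -
  have "(f u, f v) \<in> rtrancl_on (pverts U) (parcs U)" if "(u, v) \<in> rtrancl_on (pverts V) (parcs V)" for u v
    using that
  proof induct
    case base then show ?case using assms(1) by (auto simp: digraph_isom_def bij_betw_def)
  next
    case (step x y)
    then have "x \<in> pverts V" "y \<in> pverts V"
      using pair_wf_digraph.in_arcsD1[OF assms(3)] pair_wf_digraph.in_arcsD2[OF assms(3)] by blast+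
    with step have "(f x, f y) \<in> parcs U" "f x \<in> pverts U" "f y \<in> pverts U"
      using assms(1) by (auto simp: digraph_isom_def bij_betw_def)
    with step show ?case by (meson converse_rtrancl_on_into_rtrancl_on)
  qed
  moreover have "pverts U = f ` pverts V" using assms(1) by (auto simp: digraph_isom_def bij_betw_def)
  ultimately show ?thesis using assms(2)
    by (simp add: strongly_connected_def reachable_def)
qed


section \<open>Compatibility and lifts\<close>

text \<open>The hypothesis \<open>compatible\<close> is applied to a \<open>d\<close> that runs the
  automaton \<open>extend_type\<close> along \<open>c\<close> and restarts it at the points of the
  homogeneous sequence \<open>r\<close>. A walk in the resulting \<open>W\<close> projects by
  \<open>k\<close> to a walk in \<open>V\<close>, while \<open>h\<close> keeps track of types
  containing its pieces.\<close>

lemma lift_sequence_if_compatible: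
  fixes V :: "'v pair_pre_digraph" and \<phi> :: "'v \<Rightarrow> 'a"
  assumes c: "finite (range c)" and V: "strongly_connected (with_proj V)" "pair_fin_digraph V"
    "parcs V \<noteq> {}"
    and compatible: "\<And>d :: nat \<Rightarrow> 'a \<times> ('v \<times> ('v \<times> 'v) set \<times> 'v) set \<times> bool.
      finite (range d) \<Longrightarrow> (\<And>n. fst (d n) = c n) \<Longrightarrow> compatible fst (limit_digraph d) \<phi> V"
  obtains x where "finite (range x)" "limit_digraph x = V" "\<forall>\<^sub>\<infinity>n. \<phi> (x n) = c n"
proof -
  have V': "pair_wf_digraph V" "finite (pverts V)"
    using V(2) by (simp_all add: pair_fin_digraph_def pair_fin_digraph_axioms_def)
  obtain r :: "nat \<Rightarrow> nat" and t where r: "strict_mono r"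
    and t': "\<forall>i j. i < j \<longrightarrow> lift_type V \<phi> c (r i) (r j) = t"
    using ramsey_lift_type[OF V'(2), where \<phi> = \<phi> and c = c] by metis
  have t: "lift_type V \<phi> c (r i) (r j) = t" if "i < j" for i j using t' that by blast
  obtain i where i: "\<And>n. r 0 \<le> n \<Longrightarrow> r (i n) \<le> n" "\<And>n. n < r (Suc (i n))"
    "\<And>j n. r j \<le> n \<Longrightarrow> n < r (Suc j) \<Longrightarrow> i n = j"
    using strict_mono_interval[OF r] by blast
  \<comment> \<open>Homogeneity makes \<open>t\<close> closed under composition: the types of two
    adjacent blocks and of their union all equal \<open>t\<close>.\<close>
  have t_trans: "(u, E \<union> F, w) \<in> t" if "(u, E, v) \<in> t" "(v, F, w) \<in> t" for u v w E F
    using lift_type_trans[of "r 0" "r 1" "r 2" u E v V \<phi> c F w] that t[of 0 1] t[of 1 2] t[of 0 2]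
      strict_mono_less_eq[OF r] by simp
  have i_r: "i (r j) = j" for j using strict_mono_less[OF r] by (intro i(3)) auto
  \<comment> \<open>The truncation by \<open>max\<close> only serves to make the range finite.\<close>
  define s where "s = (\<lambda>n. lift_type V \<phi> c (r (i n)) (max (r (i n)) n))"
  define d where "d = (\<lambda>n. (c n, s n, n \<in> range r))"
  have s_r: "s n = {(v, {}, v) | v. v \<in> pverts V \<and> \<phi> v = c n}" if "n \<in> range r" for n
    using that by (auto simp: s_def i_r lift_type_refl)
  have s_Suc: "s (Suc n) = extend_type V \<phi> (c (Suc n)) (s n)" if "r 0 \<le> n" "Suc n \<notin> range r" for n
  proof -
    have "Suc n \<noteq> r (Suc (i n))" using that(2) by blast
    then have "Suc n < r (Suc (i n))" using i(2)[of n] by simp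
    then have "i (Suc n) = i n" using i(1)[OF that(1)] by (intro i(3)) auto
    then show ?thesis using i(1)[OF that(1)] by (simp add: s_def max_def lift_type_Suc)
  qed
  \<comment> \<open>The record is reset on arrival at a point of \<open>r\<close>, but the extension
    of the last record is the type of the completed block, which is \<open>t\<close>.\<close>
  have s_Suc_r: "extend_type V \<phi> (c (Suc n)) (s n) = t" if n: "r 0 \<le> n" "Suc n \<in> range r" for n
  proof -
    obtain j where j: "Suc n = r j" using n(2) by blast
    then have "r (i n) < r j" "r j \<le> r (Suc (i n))" using i(1)[OF n(1)] i(2)[of n] by auto
    then have "j = Suc (i n)" using r by (simp add: strict_mono_less strict_mono_less_eq)
    then have "lift_type V \<phi> c (r (i n)) (Suc n) = t" using t[of "i n" j] j by simp
    then show ?thesis using i(1)[OF n(1)] by (simp add: s_def max_def lift_type_Suc)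
  qed
  have "finite (range d)"
  proof (rule finite_subset)
    show "range d \<subseteq> range c \<times> {lift_type V \<phi> c m n | m n. m \<le> n} \<times> UNIV"
      unfolding d_def s_def by (auto intro!: exI)
  qed (intro finite_cartesian_product c finite_lift_types V'(2) finite)
  then have "compatible fst (limit_digraph d) \<phi> V" by (rule compatible) (simp add: d_def)
  then obtain W :: "nat pair_pre_digraph" and h k where W: "strongly_connected (with_proj W)"
    and h: "digraph_epi h W (limit_digraph d)" and k: "digraph_epi k W V"
    and hk: "\<And>w. w \<in> pverts W \<Longrightarrow> fst (h w) = \<phi> (k w)"
    unfolding compatible_def by blast
  have W': "pair_wf_digraph W" using k by (simp add: digraph_epi_def pair_fin_digraph_def)
  \<comment> \<open>The walk starts above a value \<open>a\<close> that \<open>d\<close> takes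
    infinitely often on \<open>range r\<close>, so that \<open>a\<close> is a vertex of the limit
    digraph and its record is the trivial type.\<close>
  have "\<exists>\<^sub>\<infinity>n. n \<in> range r"
    unfolding INFM_iff_infinite using range_inj_infinite[OF strict_mono_imp_inj_on[OF r]] by simp
  then obtain a where a: "\<exists>\<^sub>\<infinity>n. d n = a \<and> n \<in> range r"
    using infm_value[OF \<open>finite (range d)\<close>] by metis
  then have "a \<in> pverts (limit_digraph d)" by (auto simp: limit_digraph_def elim: INFM_mono)
  then obtain w0 where w0: "w0 \<in> pverts W" "h w0 = a"
    using h by (metis digraph_epi_def imageE)
  obtain n0 where n0: "h w0 = d n0" "n0 \<in> range r" using INFM_EX[OF a] w0(2) by metis
  have kV: "k w \<in> pverts V" if "w \<in> pverts W" for w using k that by (auto simp: digraph_epi_def)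
  \<comment> \<open>A walk splits at its last vertex above the homogeneous set: up to there its lift has type in \<open>t\<close>,
    and the rest is recorded in the current vertex of \<open>limit_digraph d\<close>.\<close>
  define Inv where "Inv = (\<lambda>E w. \<exists>u E1 E2. E = E1 \<union> E2 \<and> (u = k w0 \<and> E1 = {} \<or> (k w0, E1, u) \<in> t)
      \<and> (u, E2, k w) \<in> fst (snd (h w)))"
  have at_r: "fst (snd (h w)) = {(v, {}, v) | v. v \<in> pverts V \<and> \<phi> v = fst (h w)}"
    if "h w = d n" "n \<in> range r" for w n using that by (simp add: d_def s_r)
  have Inv: "Inv E w" if "walk_arcs W k w0 E w" for E w
    using that
  proof induct
    case base
    then show ?case
      unfolding Inv_def using at_r[OF n0] hk[OF w0(1)] kV[OF w0(1)] by auto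
  next
    case (step E w w')
    then obtain u E1 E2 where E: "E = E1 \<union> E2" "u = k w0 \<and> E1 = {} \<or> (k w0, E1, u) \<in> t"
      "(u, E2, k w) \<in> fst (snd (h w))" unfolding Inv_def by blast
    have w: "w \<in> pverts W" "w' \<in> pverts W"
      using pair_wf_digraph.in_arcsD1[OF W' step(3)] pair_wf_digraph.in_arcsD2[OF W' step(3)] .
    then have "(h w, h w') \<in> parcs (limit_digraph d)" "(k w, k w') \<in> parcs V"
      using h k step(3) unfolding digraph_epi_def by blast+
    \<comment> \<open>An arc of the limit digraph occurs beyond \<open>r 0\<close>. This time
      \<open>n\<close> need not be related to the times used for earlier steps of the walk: the
      invariant depends only on the value \<open>d n\<close>.\<close>
    then obtain n where n: "r 0 \<le> n" "h w = d n" "h w' = d (Suc n)"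
      unfolding limit_digraph_def INFM_nat_le by auto metis
    have ext: "(u, insert (k w, k w') E2, k w') \<in> extend_type V \<phi> (c (Suc n)) (s n)"
      using E(3) n hk[OF w(2)] kV[OF w(2)] \<open>(k w, k w') \<in> parcs V\<close>
      unfolding extend_type_def d_def by auto
    show ?case
    proof (cases "Suc n \<in> range r")
      case False
      then have "(u, insert (k w, k w') E2, k w') \<in> fst (snd (h w'))"
        using ext s_Suc n by (simp add: d_def)
      then show ?thesis unfolding Inv_def using E(1,2)
        by (intro exI[of _ u] exI[of _ E1] exI[of _ "insert (k w, k w') E2"]) auto
    next
      case True
      then have "(u, insert (k w, k w') E2, k w') \<in> t" using ext s_Suc_r n(1) by simp
      then have "(k w0, E1 \<union> insert (k w, k w') E2, k w') \<in> t"
        using E(2) t_trans[of "k w0" E1 u "insert (k w, k w') E2" "k w'"] by auto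
      moreover have "(k w', {}, k w') \<in> fst (snd (h w'))"
        using at_r[OF n(3) True] hk[OF w(2)] kV[OF w(2)] by auto
      ultimately show ?thesis unfolding Inv_def using E(1)
        by (intro exI[of _ "k w'"] exI[of _ "E1 \<union> insert (k w, k w') E2"] exI[of _ "{}"]) auto
    qed
  qed
  \<comment> \<open>Back at \<open>w0\<close> the record is trivial, so \<open>E2\<close> is empty
    and \<open>u\<close> is \<open>k w0\<close>. Thus \<open>E1\<close> is \<open>parcs V\<close>,
    which is nonempty, and only the alternative with \<open>t\<close> remains.\<close>
  have "(k w0, parcs V, k w0) \<in> t"
    using Inv[OF walk_arcs_covering[OF W k w0(1)]] V(3) unfolding Inv_def at_r[OF n0] by auto
  then have "(k w0, parcs V, k w0) \<in> lift_type V \<phi> c (r i) (r (Suc i))" for i using t by simp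
  from lift_sequence[OF r this V(2)] strongly_connected_out_arc[OF V(1,3) V'(1)]
  show thesis using that by metis
qed

section \<open>The dichotomy for a virtual refinement\<close>

theorem theorem11p3:
  fixes \<AA> :: "pfin set"
  assumes "elementary_substructure \<AA> shift"
  shows "polarized \<AA> shift"
  unfolding polarized_def
proof (intro allI impI, elim conjE)
  fix P \<phi> and V :: "nat pair_pre_digraph"
  assume P: "ba_partition \<AA> P" and ref: "virtual_refinement shift P \<phi> V"
  have V: "strongly_connected (with_proj V)" "digraph_epi \<phi> V (partition_digraph shift P)"
    "pair_fin_digraph V"
    using ref by (auto simp: virtual_refinement_def digraph_epi_def)
  have \<phi>: "\<phi> ` pverts V = P" using V(2) by (simp add: digraph_epi_def partition_digraph_def)
  have PA: "P \<subseteq> \<AA>" "finite P" using P by (auto simp: ba_partition_def)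
  obtain c where c: "range c \<subseteq> P" "\<And>a. a \<in> P \<Longrightarrow> abs_pfin {n. c n = a} = a"
    using partition_sequence[OF P] by blast
  have finc: "finite (range c)" using c(1) PA(2) finite_subset by blast
  \<comment> \<open>Some transition of \<open>c\<close> recurs, so the digraph of \<open>P\<close>
    has an arc, and the epimorphism \<open>\<phi>\<close> provides an arc of \<open>V\<close> above
    it.\<close>
  have arcs: "parcs V \<noteq> {}"
  proof -
    obtain v w where "\<exists>\<^sub>\<infinity>n. c n = v \<and> c (Suc n) = w"
    proof -
      obtain N where "(c N, c (Suc N)) \<in> parcs (limit_digraph c)"
        using MOST_nat_le[THEN iffD1, OF limit_digraph_eventually[OF finc]] by blast
      then show thesis using that by (auto simp: limit_digraph_def)
    qed
    then have *: "infinite {n. c n = v \<and> c (Suc n) = w}" by (simp add: INFM_iff_infinite)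
    then obtain n where "c n = v" "c (Suc n) = w" using not_finite_existsD by blast
    then have vw: "v \<in> P" "w \<in> P" using c(1) by auto
    have "Suc ` {n. c n = v \<and> c (Suc n) = w} = Suc ` {n. c n = v} \<inter> {n. c n = w}" by auto
    moreover have "infinite (Suc ` {n. c n = v \<and> c (Suc n) = w})"
      using * by (simp add: finite_image_iff)
    ultimately have "infinite (Suc ` {n. c n = v} \<inter> {n. c n = w})" by simp
    then have "inf (shift (abs_pfin {n. c n = v})) (abs_pfin {n. c n = w}) \<noteq> bot"
      by (simp add: shift.abs_eq inf_pfin.abs_eq abs_pfin_eq_bot_iff)
    then have "(v, w) \<in> parcs (partition_digraph shift P)"
      using vw c(2) by (simp add: partition_digraph_def)
    then show ?thesis using V(2) vw unfolding digraph_epi_def partition_digraph_def by auto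
  qed
  show "polarized_refinement \<AA> shift P \<phi> V"
  proof (rule ccontr)
    assume not_polarized: "\<not> polarized_refinement \<AA> shift P \<phi> V"
    \<comment> \<open>The fibres of an incompatible \<open>d\<close> would give a partition of
      \<open>\<P>(\<omega>)/Fin\<close> refining \<open>P\<close>. Transfer yields one in
      \<open>\<AA>\<close> with the same digraph and labels, hence also incompatible with
      \<open>\<phi>\<close>.\<close>
    have "compatible fst (limit_digraph d) \<phi> V" if d: "finite (range d)" "\<And>n. fst (d n) = c n"
      for d :: "nat \<Rightarrow> pfin \<times> (nat \<times> (nat \<times> nat) set \<times> nat) set \<times> bool"
    proof (rule ccontr)
      assume incompatible: "\<not> compatible fst (limit_digraph d) \<phi> V"
      let ?L = "limit_digraph d"
      have L: "pair_fin_digraph ?L" "pair_wf_digraph ?L" "finite (pverts ?L)"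
        using limit_digraph_fin[OF d(1)]
        by (simp_all add: pair_fin_digraph_def pair_fin_digraph_axioms_def)
      have fst: "fst ` pverts ?L \<subseteq> P"
      proof
        fix a assume "a \<in> fst ` pverts ?L"
        then obtain v n where "a = fst v" "d n = v" by (auto simp: limit_digraph_def dest!: INFM_EX)
        then show "a \<in> P" using d(2) c(1) by auto
      qed
      have "labelled_partition UNIV shift fst ?L (\<lambda>v. abs_pfin {n. d n = v})"
        using labelled_partition_limit_digraph[OF d(1) c(2) fst] d(2) by simp
      from labelled_partition_transfer[OF assms L(3) subset_trans[OF fst PA(1)] this]
      obtain f where f: "labelled_partition \<AA> shift fst ?L f" by blast
      have "\<not> compatible (natural_map P) (partition_digraph shift (f ` pverts ?L)) \<phi> V"
        using labelled_partition_compatible[OF f fst P L(1)] incompatible by blast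
      moreover have "strongly_connected (with_proj (partition_digraph shift (f ` pverts ?L)))"
        using digraph_isom_strongly_connected[OF labelled_partition_isom[OF f] _ L(2)]
          limit_digraph_strongly_connected[OF d(1)] by blast
      ultimately show False
        using labelled_partition_ba_partition[OF f L(3)] labelled_partition_refines[OF f fst]
          not_polarized
        unfolding polarized_refinement_def by blast
    qed
    from lift_sequence_if_compatible[OF finc V(1,3) arcs this] obtain x where x:
      "finite (range x)" "limit_digraph x = V" "\<forall>\<^sub>\<infinity>n. \<phi> (x n) = c n" by blast
    have fin: "finite (pverts V)"
      using V(3) by (simp add: pair_fin_digraph_def pair_fin_digraph_axioms_def)
    \<comment> \<open>The fibres of \<open>x\<close> realize \<open>\<phi>\<close> in
      \<open>\<P>(\<omega>)/Fin\<close>, and transfer then yields a realization in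
      \<open>\<AA>\<close>.\<close>
    have "labelled_partition UNIV shift \<phi> V (\<lambda>v. abs_pfin {n. x n = v})"
      using labelled_partition_limit_digraph[OF x(1) c(2), of P \<phi>] x(2,3) \<phi> by auto
    from labelled_partition_transfer[OF assms fin _ this] \<phi> PA(1)
    obtain f where "labelled_partition \<AA> shift \<phi> V f" by blast
    then have "realizes \<AA> shift (f ` pverts V) P \<phi> V"
      using \<phi> P fin by (intro labelled_partition_realizes) auto
    then show False using not_polarized unfolding polarized_refinement_def by blast
  qed
qed

end
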